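(* Let $G$ be an ample Hausdorff groupoid which is strongly effective, and let $R$ be a commutative ring with identity. Let $\mathcal{F}'$ be the set of continuous $G$-invariant functions $\rho : G^{(0)} \to \mathcal{L}(R)$. There is a bijection $\Gamma':\mathcal{F}' \to \mathcal{L}(A_R(G))$ such that $$\Gamma'(\rho) = \operatorname{span}_R\Big\{r1_B : B\text{ is a compact open bisection and }r \in \bigcap_{u \in [s(B)]} \rho(u)\Big\}.$$ Define a relation $\preccurlyeq$ on $\mathcal{F}'$ by: $\rho_1 \preccurlyeq \rho_2$ if and only if $\rho_1(u) \subseteq \rho_2(u)$ for all $u \in G^{(0)}$. Then $(\mathcal{F}', \preccurlyeq)$ is a lattice with join and meet operations given by $$(\rho_1 \vee \rho_2)(u) = \rho_1(u) + \rho_2(u) \quad\text{and}\quad (\rho_1 \wedge \rho_2)(u) = \rho_1(u) \cap \rho_2(u),$$ and $\Gamma' : (\mathcal{F}', \preccurlyeq) \to (\mathcal{L}(A_R(G)), \subseteq)$ is a lattice isomorphism.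
   Context: Groupoids. $G$ is a topological groupoid with unit space $G^{(0)}$ and range and source maps $r,s:G\to G^{(0)}$. An open bisection is an open set $B\subseteq G$ such that $r$ and $s$ restrict to homeomorphisms of $B$ onto open subsets of $G^{(0)}$. $G$ is ample if it has a basis of compact open bisections. The isotropy is $\operatorname{Iso}(G)=\{\gamma\in G: r(\gamma)=s(\gamma)\}$. An ample Hausdorff groupoid is effective if the interior of $\operatorname{Iso}(G)$ in $G$ equals $G^{(0)}$. A subset $U\subseteq G^{(0)}$ is invariant if $s(\gamma)\in U$ implies $r(\gamma)\in U$ for all $\gamma \in G$; then $G_U:=s^{-1}(U)$ is a groupoid with unit space $U$ (subspace topology). $G$ is strongly effective if $G_V$ is effective for every nonempty closed invariant $V\subseteq G^{(0)}$. For $V\subseteq G^{(0)}$, $[V]=r(s^{-1}(V))$ is the smallest invariant subset of $G^{(0)}$ containing $V$. Steinberg algebra. $A_R(G)$ is the $R$-algebra of all locally constant, compactly supported functions $f:G\to R$ with pointwise addition and convolution $(f*g)(\gamma)=\sum_{\beta: r(\beta)=r(\gamma)} f(\beta)g(\beta^{-1}\gamma)$. $1_B$ denotes the characteristic function of $B$. Ideals. $\mathcal{L}(S)$ denotes the set of two-sided ideals of a ring $S$; $\mathcal{L}(A_R(G))$ is a lattice under inclusion, with operations $+$ and $\cap$. $\mathcal{L}(R)$ carries the topology with basis the sets $Z(F)=\{I\in\mathcal{L}(R): F\subseteq I\}$, $F\subseteq R$ finite. A function $\rho:G^{(0)}\to\mathcal{L}(R)$ is $G$-invariant if $\rho(s(\gamma))=\rho(r(\gamma))$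 for all $\gamma\in G$. *)

theory Defs
  imports "HOL-Analysis.Analysis" "HOL-Algebra.Ideal" "HOL-Algebra.Module" "HOL-Algebra.Lattice"
begin

section \<open>Topological groupoids\<close>

text \<open>The set of arrows of a groupoid is the carrier (\<^const>\<open>topspace\<close>) of the topology
  \<open>gtop\<close>; the structure maps are only meaningful there.\<close>

record 'g groupoid_structure =
  gtop :: "'g topology"
  unit_space :: "'g set"
  rng :: "'g \<Rightarrow> 'g"
  src :: "'g \<Rightarrow> 'g"
  cmp :: "'g \<Rightarrow> 'g \<Rightarrow> 'g"
  ginv :: "'g \<Rightarrow> 'g"

abbreviation arrows :: "('g, 'n) groupoid_structure_scheme \<Rightarrow> 'g set" where
  "arrows G \<equiv> topspace (gtop G)"

definition composable :: "('g, 'n) groupoid_structure_scheme \<Rightarrow> ('g \<times> 'g) set" where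
  "composable G = {(a, b). a \<in> arrows G \<and> b \<in> arrows G \<and> src G a = rng G b}"

locale topological_groupoid =
  fixes G :: "('g, 'n) groupoid_structure_scheme"
  assumes units_subset: "unit_space G \<subseteq> arrows G"
    and rng_in: "a \<in> arrows G \<Longrightarrow> rng G a \<in> unit_space G"
    and src_in: "a \<in> arrows G \<Longrightarrow> src G a \<in> unit_space G"
    and rng_unit: "u \<in> unit_space G \<Longrightarrow> rng G u = u"
    and src_unit: "u \<in> unit_space G \<Longrightarrow> src G u = u"
    and cmp_in: "(a, b) \<in> composable G \<Longrightarrow> cmp G a b \<in> arrows G"
    and rng_cmp: "(a, b) \<in> composable G \<Longrightarrow> rng G (cmp G a b) = rng G a"
    and src_cmp: "(a, b) \<in> composable G \<Longrightarrow> src G (cmp G a b) = src G b"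
    and cmp_assoc: "\<lbrakk>(a, b) \<in> composable G; (b, c) \<in> composable G\<rbrakk>
      \<Longrightarrow> cmp G (cmp G a b) c = cmp G a (cmp G b c)"
    and cmp_rng: "a \<in> arrows G \<Longrightarrow> cmp G (rng G a) a = a"
    and cmp_src: "a \<in> arrows G \<Longrightarrow> cmp G a (src G a) = a"
    and ginv_in: "a \<in> arrows G \<Longrightarrow> ginv G a \<in> arrows G"
    and rng_ginv: "a \<in> arrows G \<Longrightarrow> rng G (ginv G a) = src G a"
    and src_ginv: "a \<in> arrows G \<Longrightarrow> src G (ginv G a) = rng G a"
    and cmp_ginv_right: "a \<in> arrows G \<Longrightarrow> cmp G a (ginv G a) = rng G a"
    and cmp_ginv_left: "a \<in> arrows G \<Longrightarrow> cmp G (ginv G a) a = src G a"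
    and continuous_cmp:
      "continuous_map (subtopology (prod_topology (gtop G) (gtop G)) (composable G)) (gtop G)
         (\<lambda>(a, b). cmp G a b)"
    and continuous_ginv: "continuous_map (gtop G) (gtop G) (ginv G)"

abbreviation unit_top :: "('g, 'n) groupoid_structure_scheme \<Rightarrow> 'g topology" where
  "unit_top G \<equiv> subtopology (gtop G) (unit_space G)"

definition open_bisection :: "('g, 'n) groupoid_structure_scheme \<Rightarrow> 'g set \<Rightarrow> bool" where
  "open_bisection G B \<longleftrightarrow> openin (gtop G) B \<and>
     (\<forall>p \<in> {rng G, src G}. openin (unit_top G) (p ` B) \<and>
        homeomorphic_map (subtopology (gtop G) B) (subtopology (unit_top G) (p ` B)) p)"

definition compact_open_bisection :: "('g, 'n) groupoid_structure_scheme \<Rightarrow> 'g set \<Rightarrow> bool" where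
  "compact_open_bisection G B \<longleftrightarrow> open_bisection G B \<and> compactin (gtop G) B"

locale ample_groupoid = topological_groupoid +
  assumes ample_basis: "\<lbrakk>openin (gtop G) U; a \<in> U\<rbrakk>
    \<Longrightarrow> \<exists>B. compact_open_bisection G B \<and> a \<in> B \<and> B \<subseteq> U"

locale ample_Hausdorff_groupoid = ample_groupoid +
  assumes Hausdorff: "Hausdorff_space (gtop G)"

definition isotropy :: "('g, 'n) groupoid_structure_scheme \<Rightarrow> 'g set" where
  "isotropy G = {a \<in> arrows G. rng G a = src G a}"

definition effective :: "('g, 'n) groupoid_structure_scheme \<Rightarrow> bool" where
  "effective G \<longleftrightarrow> gtop G interior_of isotropy G = unit_space G"

definition invariant :: "('g, 'n) groupoid_structure_scheme \<Rightarrow> 'g set \<Rightarrow> bool" where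
  "invariant G U \<longleftrightarrow> U \<subseteq> unit_space G \<and> (\<forall>a \<in> arrows G. src G a \<in> U \<longrightarrow> rng G a \<in> U)"

definition restriction ::
  "('g, 'n) groupoid_structure_scheme \<Rightarrow> 'g set \<Rightarrow> ('g, 'n) groupoid_structure_scheme" where
  "restriction G U =
     G\<lparr>gtop := subtopology (gtop G) {a \<in> arrows G. src G a \<in> U}, unit_space := U\<rparr>"

definition strongly_effective :: "('g, 'n) groupoid_structure_scheme \<Rightarrow> bool" where
  "strongly_effective G \<longleftrightarrow>
     (\<forall>V. V \<noteq> {} \<and> closedin (unit_top G) V \<and> invariant G V \<longrightarrow> effective (restriction G V))"

definition invariant_hull :: "('g, 'n) groupoid_structure_scheme \<Rightarrow> 'g set \<Rightarrow> 'g set" where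
  "invariant_hull G V = rng G ` {a \<in> arrows G. src G a \<in> V}"

section \<open>The Steinberg algebra\<close>

text \<open>A function from \<open>G\<close> to \<open>R\<close> is an element of \<open>arrows G \<rightarrow>\<^sub>E carrier R\<close>, that is,
  it takes the value \<^const>\<open>undefined\<close> outside the set of arrows.\<close>

definition steinberg_carrier ::
  "('r, 'm) ring_scheme \<Rightarrow> ('g, 'n) groupoid_structure_scheme \<Rightarrow> ('g \<Rightarrow> 'r) set" where
  "steinberg_carrier R G = {f \<in> arrows G \<rightarrow>\<^sub>E carrier R.
     (\<forall>a \<in> arrows G. \<exists>U. openin (gtop G) U \<and> a \<in> U \<and> (\<forall>b \<in> U. f b = f a)) \<and>
     compactin (gtop G) (gtop G closure_of {a \<in> arrows G. f a \<noteq> \<zero>\<^bsub>R\<^esub>})}"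

definition char_fun ::
  "('r, 'm) ring_scheme \<Rightarrow> ('g, 'n) groupoid_structure_scheme \<Rightarrow> 'g set \<Rightarrow> 'g \<Rightarrow> 'r" where
  "char_fun R G B = (\<lambda>a \<in> arrows G. if a \<in> B then \<one>\<^bsub>R\<^esub> else \<zero>\<^bsub>R\<^esub>)"

text \<open>The index set of the convolution sum is cut down to the non-zero terms (finitely many,
  for functions in the Steinberg algebra of an ample Hausdorff groupoid), because
  \<^const>\<open>finsum\<close> over an infinite set is zero by convention.\<close>

definition convolution ::
  "('r, 'm) ring_scheme \<Rightarrow> ('g, 'n) groupoid_structure_scheme \<Rightarrow>
     ('g \<Rightarrow> 'r) \<Rightarrow> ('g \<Rightarrow> 'r) \<Rightarrow> 'g \<Rightarrow> 'r" where
  "convolution R G f g = (\<lambda>c \<in> arrows G.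
     \<Oplus>\<^bsub>R\<^esub> b \<in> {b \<in> arrows G. rng G b = rng G c \<and>
                  f b \<otimes>\<^bsub>R\<^esub> g (cmp G (ginv G b) c) \<noteq> \<zero>\<^bsub>R\<^esub>}.
       f b \<otimes>\<^bsub>R\<^esub> g (cmp G (ginv G b) c))"

text \<open>The algebra has an identity only if the unit space is compact.  The record field
  \<open>one\<close> must nevertheless be filled; nothing below refers to it, and in particular no
  locale that requires a multiplicative identity is assumed of this structure.\<close>

definition steinberg_algebra ::
  "('r, 'm) ring_scheme \<Rightarrow> ('g, 'n) groupoid_structure_scheme \<Rightarrow> ('r, 'g \<Rightarrow> 'r) module" where
  "steinberg_algebra R G =
     \<lparr>carrier = steinberg_carrier R G,
      mult = convolution R G,
      one = char_fun R G (unit_space G),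
      zero = (\<lambda>a \<in> arrows G. \<zero>\<^bsub>R\<^esub>),
      add = (\<lambda>f g. \<lambda>a \<in> arrows G. f a \<oplus>\<^bsub>R\<^esub> g a),
      smult = (\<lambda>c f. \<lambda>a \<in> arrows G. c \<otimes>\<^bsub>R\<^esub> f a)\<rparr>"

definition module_span ::
  "('r, 'm) ring_scheme \<Rightarrow> ('r, 'a, 'n) module_scheme \<Rightarrow> 'a set \<Rightarrow> 'a set" where
  "module_span R M X = \<Inter>{N. submodule N R M \<and> X \<subseteq> N}"

section \<open>Ideals\<close>

text \<open>The locale \<^locale>\<open>ideal\<close> presupposes a ring with identity, whereas Steinberg algebras
  need not have one.\<close>

definition two_sided_ideals :: "('a, 'm) ring_scheme \<Rightarrow> 'a set set" where
  "two_sided_ideals S = {I. additive_subgroup I S \<and>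
     (\<forall>a \<in> I. \<forall>x \<in> carrier S. x \<otimes>\<^bsub>S\<^esub> a \<in> I \<and> a \<otimes>\<^bsub>S\<^esub> x \<in> I)}"

lemma (in ring) two_sided_ideals_eq: "two_sided_ideals R = {I. ideal I R}"
  unfolding two_sided_ideals_def ideal_def ideal_axioms_def
  using ring_axioms by auto

definition ideal_lattice :: "('a, 'm) ring_scheme \<Rightarrow> 'a set gorder" where
  "ideal_lattice S = \<lparr>carrier = two_sided_ideals S, eq = (=), le = (\<subseteq>)\<rparr>"

text \<open>The lattice operations of \<open>ideal_lattice S\<close> are sum and intersection; no
  multiplicative identity and no associativity of the multiplication is needed.\<close>

context abelian_group
begin

context
  assumes mult_closed: "\<And>x y. \<lbrakk>x \<in> carrier G; y \<in> carrier G\<rbrakk> \<Longrightarrow> x \<otimes> y \<in> carrier G"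
    and distr_left: "\<And>x y z. \<lbrakk>x \<in> carrier G; y \<in> carrier G; z \<in> carrier G\<rbrakk>
      \<Longrightarrow> (x \<oplus> y) \<otimes> z = x \<otimes> z \<oplus> y \<otimes> z"
    and distr_right: "\<And>x y z. \<lbrakk>x \<in> carrier G; y \<in> carrier G; z \<in> carrier G\<rbrakk>
      \<Longrightarrow> z \<otimes> (x \<oplus> y) = z \<otimes> x \<oplus> z \<otimes> y"
begin

lemma two_sided_ideals_Int:
  assumes "I \<in> two_sided_ideals G" "J \<in> two_sided_ideals G"
  shows "I \<inter> J \<in> two_sided_ideals G"
  using assms add.subgroups_Inter_pair
  unfolding two_sided_ideals_def additive_subgroup_def by auto

lemma two_sided_ideals_add:
  assumes I: "I \<in> two_sided_ideals G" and J: "J \<in> two_sided_ideals G"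
  shows "I <+>\<^bsub>G\<^esub> J \<in> two_sided_ideals G"
proof -
  have sub: "I \<subseteq> carrier G" "J \<subseteq> carrier G"
    using I J additive_subgroup.a_subset unfolding two_sided_ideals_def by blast+
  have "additive_subgroup (I <+>\<^bsub>G\<^esub> J) G"
    using I J add_additive_subgroups unfolding two_sided_ideals_def by blast
  moreover have "x \<otimes> a \<in> I <+>\<^bsub>G\<^esub> J \<and> a \<otimes> x \<in> I <+>\<^bsub>G\<^esub> J"
    if a: "a \<in> I <+>\<^bsub>G\<^esub> J" and x: "x \<in> carrier G" for a x
  proof -
    obtain i j where ij: "i \<in> I" "j \<in> J" "a = i \<oplus> j"
      using a unfolding set_add_def' by blast
    then have "i \<in> carrier G" "j \<in> carrier G" using sub by auto
    then have "x \<otimes> a = x \<otimes> i \<oplus> x \<otimes> j" "a \<otimes> x = i \<otimes> x \<oplus> j \<otimes> x"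
      using ij(3) x by (simp_all add: distr_left distr_right)
    moreover have "x \<otimes> i \<in> I" "i \<otimes> x \<in> I" "x \<otimes> j \<in> J" "j \<otimes> x \<in> J"
      using ij I J x by (auto simp: two_sided_ideals_def)
    ultimately show ?thesis unfolding set_add_def' by auto
  qed
  ultimately show ?thesis unfolding two_sided_ideals_def by blast
qed

lemma least_ideal_add:
  assumes I: "I \<in> two_sided_ideals G" and J: "J \<in> two_sided_ideals G"
  shows "least (ideal_lattice G) (I <+>\<^bsub>G\<^esub> J) (Upper (ideal_lattice G) {I, J})"
proof -
  have sI: "additive_subgroup I G" and sJ: "additive_subgroup J G"
    using I J unfolding two_sided_ideals_def by blast+
  have I': "I \<subseteq> I <+>\<^bsub>G\<^esub> J"
  proof
    fix x assume x: "x \<in> I"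
    then have "x = x \<oplus> \<zero>" using additive_subgroup.a_Hcarr[OF sI] by simp
    then show "x \<in> I <+>\<^bsub>G\<^esub> J"
      using x additive_subgroup.zero_closed[OF sJ] unfolding set_add_def' by blast
  qed
  have J': "J \<subseteq> I <+>\<^bsub>G\<^esub> J"
  proof
    fix x assume x: "x \<in> J"
    then have "x = \<zero> \<oplus> x" using additive_subgroup.a_Hcarr[OF sJ] by simp
    then show "x \<in> I <+>\<^bsub>G\<^esub> J"
      using x additive_subgroup.zero_closed[OF sI] unfolding set_add_def' by blast
  qed
  have K': "I <+>\<^bsub>G\<^esub> J \<subseteq> K" if "K \<in> two_sided_ideals G" "I \<subseteq> K" "J \<subseteq> K" for K
  proof -
    have "additive_subgroup K G" using that(1) by (simp add: two_sided_ideals_def)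
    then show ?thesis
      using that(2,3) additive_subgroup.a_closed[of K G] unfolding set_add_def' by auto
  qed
  show ?thesis
    using I J two_sided_ideals_add[OF I J] I' J' K'
    unfolding least_def Upper_def ideal_lattice_def by auto
qed

lemma greatest_ideal_Int:
  assumes "I \<in> two_sided_ideals G" "J \<in> two_sided_ideals G"
  shows "greatest (ideal_lattice G) (I \<inter> J) (Lower (ideal_lattice G) {I, J})"
  using assms two_sided_ideals_Int[OF assms]
  unfolding greatest_def Lower_def ideal_lattice_def by auto

lemma lattice_ideal_lattice: "Lattice.lattice (ideal_lattice G)"
proof -
  have "partial_order (ideal_lattice G)"
    by unfold_locales (auto simp: ideal_lattice_def)
  moreover have "carrier (ideal_lattice G) = two_sided_ideals G"
    by (simp add: ideal_lattice_def)
  ultimately show ?thesis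
    by (intro Lattice.lattice.intro upper_semilattice.intro lower_semilattice.intro
        upper_semilattice_axioms.intro lower_semilattice_axioms.intro)
      (metis least_ideal_add greatest_ideal_Int)+
qed

lemma ideal_lattice_join:
  assumes "I \<in> two_sided_ideals G" "J \<in> two_sided_ideals G"
  shows "I \<squnion>\<^bsub>ideal_lattice G\<^esub> J = I <+>\<^bsub>G\<^esub> J"
proof -
  interpret L: Lattice.lattice "ideal_lattice G" by (rule lattice_ideal_lattice)
  have "least (ideal_lattice G) (I \<squnion>\<^bsub>ideal_lattice G\<^esub> J) (Upper (ideal_lattice G) {I, J})"
    using least_ideal_add[OF assms] unfolding join_def Lattice.sup_def by (rule someI)
  then show ?thesis using least_ideal_add[OF assms] L.least_unique by blast
qed

lemma ideal_lattice_meet: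
  assumes "I \<in> two_sided_ideals G" "J \<in> two_sided_ideals G"
  shows "I \<sqinter>\<^bsub>ideal_lattice G\<^esub> J = I \<inter> J"
proof -
  interpret L: Lattice.lattice "ideal_lattice G" by (rule lattice_ideal_lattice)
  have "greatest (ideal_lattice G) (I \<sqinter>\<^bsub>ideal_lattice G\<^esub> J) (Lower (ideal_lattice G) {I, J})"
    using greatest_ideal_Int[OF assms] unfolding meet_def Lattice.inf_def by (rule someI)
  then show ?thesis using greatest_ideal_Int[OF assms] L.greatest_unique by blast
qed

end

end

definition ideal_topology :: "('a, 'm) ring_scheme \<Rightarrow> 'a set topology" where
  "ideal_topology R = topology_generated_by
     {{I \<in> two_sided_ideals R. F \<subseteq> I} | F. F \<subseteq> carrier R \<and> finite F}"

section \<open>Invariant functions and lattice isomorphisms\<close>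

definition invariant_functions ::
  "('r, 'm) ring_scheme \<Rightarrow> ('g, 'n) groupoid_structure_scheme \<Rightarrow> ('g \<Rightarrow> 'r set) set" where
  "invariant_functions R G = {\<rho> \<in> unit_space G \<rightarrow>\<^sub>E two_sided_ideals R.
     continuous_map (unit_top G) (ideal_topology R) \<rho> \<and>
     (\<forall>a \<in> arrows G. \<rho> (src G a) = \<rho> (rng G a))}"

definition invariant_function_lattice ::
  "('r, 'm) ring_scheme \<Rightarrow> ('g, 'n) groupoid_structure_scheme \<Rightarrow> ('g \<Rightarrow> 'r set) gorder" where
  "invariant_function_lattice R G =
     \<lparr>carrier = invariant_functions R G, eq = (=),
      le = (\<lambda>\<rho>\<^sub>1 \<rho>\<^sub>2. \<forall>u \<in> unit_space G. \<rho>\<^sub>1 u \<subseteq> \<rho>\<^sub>2 u)\<rparr>"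

definition lattice_isomorphism :: "('a, 'm) gorder_scheme \<Rightarrow> ('b, 'n) gorder_scheme \<Rightarrow> ('a \<Rightarrow> 'b) \<Rightarrow> bool"
  where
  "lattice_isomorphism L M h \<longleftrightarrow> Lattice.lattice L \<and> Lattice.lattice M \<and>
     bij_betw h (carrier L) (carrier M) \<and>
     (\<forall>x \<in> carrier L. \<forall>y \<in> carrier L.
        h (x \<squnion>\<^bsub>L\<^esub> y) = h x \<squnion>\<^bsub>M\<^esub> h y \<and> h (x \<sqinter>\<^bsub>L\<^esub> y) = h x \<sqinter>\<^bsub>M\<^esub> h y)"

end

theory Submission
  imports Defs
begin

text \<open>An ideal \<open>I\<close> corresponds to \<open>u \<mapsto> {f u | f \<in> I}\<close>, and an invariant function \<open>\<rho>\<close> to the ideal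
  of all \<open>f\<close> with \<open>f a \<in> \<rho> (s a)\<close> for every arrow \<open>a\<close>, which is the span in the statement.
  That \<open>I\<close> is recovered from its function rests on one fact: if \<open>f \<in> I\<close> takes the value \<open>r\<close>
  at a unit \<open>u\<close>, then \<open>I\<close> contains \<open>r\<close> times the characteristic function of a neighbourhood of \<open>u\<close>
  in the unit space. Multiplying by bisections and summing over a partition of the support then
  puts every function with values in the function of \<open>I\<close> into \<open>I\<close>.
  The bijection preserves and reflects the order, so it carries the lattice structure over.\<close>

section \<open>Ample groupoids\<close>

text \<open>Cutting \<open>f\<close> on both sides by the characteristic function of a set
  \<open>L\<close> of units keeps exactly the values of \<open>f\<close> on arrows with both ends in
  \<open>L\<close>. Arrows of the support with two different ends are removed by shrinking
  \<open>L\<close>, nontrivial isotropy at the chosen unit is not. Effectiveness removes this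
  obstacle only by passing to a nearby unit, so it proves nothing directly about the unit one
  started from. Hence the argument is by contradiction, and the nearby unit must be found inside the
  set of units where the claim fails. That set is not known in advance, which is why effectiveness
  is assumed for the reduction to every nonempty closed invariant set. \<open>A\<close> may lack an
  identity, and its ideals are only assumed to be additive subgroups closed under convolution. The
  functions c 1_K, with K a compact open set of units, make up for both: they serve as local
  identities and as local scalars. A convolution with c 1_B for a bisection B has at most one
  nonzero term at each arrow, so such products are computed pointwise.\<close>

context topological_groupoid
begin

section \<open>Cancellation laws and continuity of the structure maps\<close>

lemma composable_iff: "(a, b) \<in> composable G \<longleftrightarrow> a \<in> arrows G \<and> b \<in> arrows G \<and> src G a = rng G b"
  by (simp add: composable_def)

lemma unit_in_arrows: "u \<in> unit_space G \<Longrightarrow> u \<in> arrows G"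
  using units_subset by blast

lemma cmp_closed:
  assumes "a \<in> arrows G" "b \<in> arrows G" "src G a = rng G b"
  shows "cmp G a b \<in> arrows G" "rng G (cmp G a b) = rng G a" "src G (cmp G a b) = src G b"
  using assms cmp_in rng_cmp src_cmp by (simp_all add: composable_iff)

lemma ginv_cmp_cancel:
  assumes "b \<in> arrows G" "d \<in> arrows G" "src G b = rng G d"
  shows "cmp G (ginv G b) (cmp G b d) = d"
  using assms cmp_assoc[of "ginv G b" b d]
  by (simp add: composable_iff ginv_in src_ginv cmp_ginv_left cmp_rng)

lemma cmp_ginv_cancel:
  assumes "b \<in> arrows G" "d \<in> arrows G" "rng G b = rng G d"
  shows "cmp G b (cmp G (ginv G b) d) = d"
  using assms cmp_assoc[of b "ginv G b" d]
  by (simp add: composable_iff ginv_in src_ginv rng_ginv cmp_ginv_right cmp_rng)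

lemma ginv_ginv:
  assumes a: "a \<in> arrows G"
  shows "ginv G (ginv G a) = a"
proof -
  have "a = cmp G a (cmp G (ginv G a) (ginv G (ginv G a)))"
    using a by (simp add: ginv_in cmp_ginv_right rng_ginv cmp_src)
  also have "\<dots> = ginv G (ginv G a)"
    using a by (intro cmp_ginv_cancel) (simp_all add: ginv_in src_ginv rng_ginv)
  finally show ?thesis by simp
qed

lemma cmp_cmp_ginv:
  assumes "a \<in> arrows G" "b \<in> arrows G" "src G a = rng G b"
  shows "cmp G (cmp G a b) (ginv G b) = a"
  using assms cmp_assoc[of a b "ginv G b"] cmp_src[of a]
  by (simp add: composable_iff ginv_in rng_ginv cmp_ginv_right)

text \<open>Only composition and inversion are continuous by assumption; the range map is
  \<open>a\<close> composed with its inverse.\<close>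

lemma continuous_rng: "continuous_map (gtop G) (gtop G) (rng G)"
proof -
  have "continuous_map (gtop G) (subtopology (prod_topology (gtop G) (gtop G)) (composable G))
      (\<lambda>a. (a, ginv G a))"
    by (auto simp: continuous_map_in_subtopology continuous_map_pairedI continuous_ginv
        composable_iff ginv_in rng_ginv)
  from continuous_map_compose[OF this continuous_cmp]
  have "continuous_map (gtop G) (gtop G) (\<lambda>a. cmp G a (ginv G a))"
    by (simp add: o_def)
  then show ?thesis
    by (rule continuous_map_eq) (simp add: cmp_ginv_right)
qed

lemma continuous_src: "continuous_map (gtop G) (gtop G) (src G)"
  using continuous_map_compose[OF continuous_ginv continuous_rng]
  by (rule continuous_map_eq) (simp add: rng_ginv)

lemma openin_rng_vimage: "openin (gtop G) U \<Longrightarrow> openin (gtop G) {a \<in> arrows G. rng G a \<in> U}"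
  and openin_src_vimage: "openin (gtop G) U \<Longrightarrow> openin (gtop G) {a \<in> arrows G. src G a \<in> U}"
  and openin_ginv_vimage: "openin (gtop G) U \<Longrightarrow> openin (gtop G) {a \<in> arrows G. ginv G a \<in> U}"
  using continuous_rng continuous_src continuous_ginv openin_continuous_map_preimage by blast+

text \<open>Joint continuity of composition in box form. The open sets of the subspace of composable
  pairs are traces of open sets of the product, and these contain boxes.\<close>

lemma cmp_nbhd:
  assumes "(x, y) \<in> composable G" "openin (gtop G) D" "cmp G x y \<in> D"
  obtains M N where "openin (gtop G) M" "openin (gtop G) N" "x \<in> M" "y \<in> N"
    "\<And>a b. \<lbrakk>a \<in> M; b \<in> N; (a, b) \<in> composable G\<rbrakk> \<Longrightarrow> cmp G a b \<in> D"
proof -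
  let ?P = "prod_topology (gtop G) (gtop G)"
  have "openin (subtopology ?P (composable G))
      {p \<in> topspace (subtopology ?P (composable G)). (\<lambda>(a, b). cmp G a b) p \<in> D}"
    using openin_continuous_map_preimage[OF continuous_cmp assms(2)] .
  then obtain T where T: "openin ?P T"
    "{p \<in> topspace (subtopology ?P (composable G)). (\<lambda>(a, b). cmp G a b) p \<in> D} = T \<inter> composable G"
    unfolding openin_subtopology by blast
  have "(x, y) \<in> {p \<in> topspace (subtopology ?P (composable G)). (\<lambda>(a, b). cmp G a b) p \<in> D}"
    using assms(1,3) by (simp add: composable_iff)
  then have "(x, y) \<in> T" unfolding T(2) by blast
  from T(1)[unfolded openin_prod_topology_alt, rule_format, OF this]
  obtain M N where MN: "openin (gtop G) M" "openin (gtop G) N" "x \<in> M" "y \<in> N" "M \<times> N \<subseteq> T"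
    by blast
  have "cmp G a b \<in> D" if "a \<in> M" "b \<in> N" "(a, b) \<in> composable G" for a b
  proof -
    have "(a, b) \<in> T \<inter> composable G" using that MN(5) by blast
    then show ?thesis unfolding T(2)[symmetric] by simp
  qed
  with MN that show thesis by blast
qed

end

section \<open>Open units, open range and source maps, and a criterion for bisections\<close>

context ample_groupoid
begin

text \<open>If \<open>b\<close> and \<open>rng G b\<close> both lie in a bisection, they have the
  same range and so coincide, which makes \<open>b\<close> a unit. Thus a bisection around
  \<open>u\<close>, cut down to the arrows with range in it, is an open set of units.\<close>

lemma open_units: "openin (gtop G) (unit_space G)"
proof (subst openin_subopen, intro ballI)
  fix u assume u: "u \<in> unit_space G"
  obtain B where B: "compact_open_bisection G B" "u \<in> B"
    using ample_basis[OF openin_topspace] u unit_in_arrows by blast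
  have oB: "openin (gtop G) B" and inj: "inj_on (rng G) B"
    using B(1) unfolding compact_open_bisection_def open_bisection_def homeomorphic_eq_everything_map
    by (auto simp: Int_absorb1 openin_subset)
  have "b \<in> unit_space G" if "b \<in> B" "rng G b \<in> B" for b
    using that inj_onD[OF inj, of b "rng G b"] oB openin_subset rng_in rng_unit
    by (metis subsetD)
  moreover have "openin (gtop G) (B \<inter> {a \<in> arrows G. rng G a \<in> B})"
    using oB openin_rng_vimage by blast
  ultimately show "\<exists>T. openin (gtop G) T \<and> u \<in> T \<and> T \<subseteq> unit_space G"
    using B(2) u by (intro exI[of _ "B \<inter> {a \<in> arrows G. rng G a \<in> B}"])
      (auto simp: rng_unit unit_in_arrows)
qed

lemma openin_unit_top_iff: "openin (unit_top G) U \<longleftrightarrow> openin (gtop G) U \<and> U \<subseteq> unit_space G"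
  using openin_open_subtopology[OF open_units] by blast

lemma bisectionD:
  assumes "compact_open_bisection G B"
  shows "openin (gtop G) B" "compactin (gtop G) B" "inj_on (rng G) B" "inj_on (src G) B" "B \<subseteq> arrows G"
  using assms unfolding compact_open_bisection_def open_bisection_def homeomorphic_eq_everything_map
  by (auto simp: Int_absorb1 openin_subset)

text \<open>An open set is a union of bisections, and the image of each of these is open by
  definition.\<close>

lemma open_map_rng: "openin (gtop G) U \<Longrightarrow> openin (gtop G) (rng G ` U)"
  and open_map_src: "openin (gtop G) U \<Longrightarrow> openin (gtop G) (src G ` U)"
proof -
  have *: "openin (gtop G) (p ` U)" if U: "openin (gtop G) U" and p: "p \<in> {rng G, src G}" for p
  proof (subst openin_subopen, intro ballI)
    fix x assume "x \<in> p ` U"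
    then obtain a where a: "a \<in> U" "x = p a" by blast
    then obtain B where B: "compact_open_bisection G B" "a \<in> B" "B \<subseteq> U"
      using ample_basis[OF U] by blast
    then have "openin (gtop G) (p ` B)"
      using p unfolding compact_open_bisection_def open_bisection_def openin_unit_top_iff by blast
    then show "\<exists>T. openin (gtop G) T \<and> x \<in> T \<and> T \<subseteq> p ` U"
      using a B by blast
  qed
  show "openin (gtop G) U \<Longrightarrow> openin (gtop G) (rng G ` U)"
    "openin (gtop G) U \<Longrightarrow> openin (gtop G) (src G ` U)"
    using * by blast+
qed

text \<open>Range and source are continuous open maps on all of \<open>G\<close>, so injectivity on
  an open set already makes them homeomorphisms onto open images.\<close>

lemma compact_open_bisectionI:
  assumes "openin (gtop G) B" "compactin (gtop G) B" "inj_on (rng G) B" "inj_on (src G) B"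
  shows "compact_open_bisection G B"
proof -
  have sub: "B \<subseteq> arrows G" using assms(1) openin_subset by blast
  have "openin (unit_top G) (p ` B) \<and>
      homeomorphic_map (subtopology (gtop G) B) (subtopology (unit_top G) (p ` B)) p"
    if p: "p \<in> {rng G, src G}" for p
  proof
    have pU: "p ` U \<subseteq> unit_space G" if "U \<subseteq> arrows G" for U
      using p that rng_in src_in by blast
    have op: "openin (gtop G) (p ` U)" if "openin (gtop G) U" for U
      using p that open_map_rng open_map_src by blast
    show "openin (unit_top G) (p ` B)"
      using op assms(1) pU[OF sub] by (simp add: openin_unit_top_iff)
    have eq: "subtopology (unit_top G) (p ` B) = subtopology (gtop G) (p ` B)"
      using pU[OF sub] by (simp add: subtopology_subtopology Int_absorb1)
    have ts: "topspace (subtopology (gtop G) B) = B"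
      using sub by auto
    have "p ` B \<subseteq> arrows G"
      using pU[OF sub] units_subset by blast
    show "homeomorphic_map (subtopology (gtop G) B) (subtopology (unit_top G) (p ` B)) p"
      unfolding eq
    proof (rule bijective_open_imp_homeomorphic_map)
      show "continuous_map (subtopology (gtop G) B) (subtopology (gtop G) (p ` B)) p"
        using p continuous_rng continuous_src sub
        by (auto simp: continuous_map_in_subtopology continuous_map_from_subtopology)
      show "open_map (subtopology (gtop G) B) (subtopology (gtop G) (p ` B)) p"
        unfolding open_map_def
        using op assms(1) by (auto simp: openin_open_subtopology image_mono)
      show "p ` topspace (subtopology (gtop G) B) = topspace (subtopology (gtop G) (p ` B))"
        using \<open>p ` B \<subseteq> arrows G\<close> ts by auto
      show "inj_on p (topspace (subtopology (gtop G) B))"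
        using p assms(3,4) ts by auto
    qed
  qed
  then show ?thesis
    using assms unfolding compact_open_bisection_def open_bisection_def by blast
qed

lemma compact_open_units_bisection:
  assumes "openin (gtop G) K" "compactin (gtop G) K" "K \<subseteq> unit_space G"
  shows "compact_open_bisection G K"
  using assms by (intro compact_open_bisectionI inj_onI) (metis rng_unit src_unit subsetD)+

lemma ginv_image_eq: "B \<subseteq> arrows G \<Longrightarrow> ginv G ` B = {a \<in> arrows G. ginv G a \<in> B}"
  by (auto simp: ginv_in ginv_ginv image_iff) (metis ginv_ginv)

lemma ginv_bisection:
  assumes "compact_open_bisection G B"
  shows "compact_open_bisection G (ginv G ` B)"
proof (rule compact_open_bisectionI)
  note B = bisectionD[OF assms]
  show "openin (gtop G) (ginv G ` B)"
    using B by (simp add: ginv_image_eq openin_ginv_vimage)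
  show "compactin (gtop G) (ginv G ` B)"
    using B(2) continuous_ginv image_compactin by blast
  show "inj_on (rng G) (ginv G ` B)" "inj_on (src G) (ginv G ` B)"
    using B(3-5) by (auto simp: inj_on_def rng_ginv src_ginv subset_iff)
qed

lemma unit_nbhd:
  assumes "openin (gtop G) U" "u \<in> U" "u \<in> unit_space G"
  obtains K where "compact_open_bisection G K" "u \<in> K" "K \<subseteq> U" "K \<subseteq> unit_space G"
  using ample_basis[of "U \<inter> unit_space G" u] assms open_units by auto

end

section \<open>Closed and compact sets in the Hausdorff case\<close>

context ample_Hausdorff_groupoid
begin

text \<open>The units are the fixed points of the continuous map \<open>rng G\<close>, and
  equalizers in a Hausdorff space are closed.\<close>

lemma closed_units: "closedin (gtop G) (unit_space G)"
proof -
  have "unit_space G = {a \<in> arrows G. rng G a = a}"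
    using rng_in rng_unit unit_in_arrows by force
  then show ?thesis
    using closedin_continuous_maps_eq[OF Hausdorff continuous_rng continuous_map_id] by simp
qed

lemma closed_bisection: "compact_open_bisection G B \<Longrightarrow> closedin (gtop G) B"
  using bisectionD(2) compactin_imp_closedin Hausdorff by blast

lemma bisection_subset:
  assumes B: "compact_open_bisection G B" and C: "C \<subseteq> B" "openin (gtop G) C" "closedin (gtop G) C"
  shows "compact_open_bisection G C"
  using C bisectionD[OF B] closed_compactin inj_on_subset
  by (intro compact_open_bisectionI) blast+

text \<open>Composable pairs form an equalizer, hence a closed set, so the composable part of a
  compact box is compact. This bounds the support of a convolution.\<close>

lemma compact_product:
  assumes "compactin (gtop G) S" "compactin (gtop G) T"
  shows "compactin (gtop G) ((\<lambda>(a, b). cmp G a b) ` (S \<times> T \<inter> composable G))"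
proof -
  let ?P = "prod_topology (gtop G) (gtop G)"
  have "continuous_map ?P (gtop G) (src G \<circ> fst)" "continuous_map ?P (gtop G) (rng G \<circ> snd)"
    using continuous_map_compose continuous_map_fst continuous_map_snd continuous_src continuous_rng
    by blast+
  from closedin_continuous_maps_eq[OF Hausdorff this]
  have "closedin ?P (composable G)"
    by (rule back_subst) (auto simp: composable_iff)
  moreover have "compactin ?P (S \<times> T)"
    using assms by (simp add: compactin_Times)
  ultimately have "compactin (subtopology ?P (composable G)) (S \<times> T \<inter> composable G)"
    by (simp add: compactin_subtopology compact_Int_closedin)
  then show ?thesis using continuous_cmp image_compactin by blast
qed

text \<open>The image of \<open>D\<close> under the pair (range, source) is compact, hence closed in
  the product, and it misses \<open>(v, v)\<close>. A box around \<open>(v, v)\<close> in the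
  complement, symmetrized by intersecting its sides, gives \<open>U\<close>.\<close>

lemma no_isotropy_nbhd:
  assumes D: "compactin (gtop G) D" and v: "v \<in> unit_space G"
    and iso: "\<And>b. b \<in> D \<Longrightarrow> \<not> (rng G b = v \<and> src G b = v)"
  obtains U where "openin (gtop G) U" "v \<in> U" "\<And>b. b \<in> D \<Longrightarrow> \<not> (rng G b \<in> U \<and> src G b \<in> U)"
proof -
  let ?P = "prod_topology (gtop G) (gtop G)" and ?E = "(\<lambda>b. (rng G b, src G b)) ` D"
  have "compactin ?P ?E"
    using D image_compactin continuous_map_pairedI continuous_rng continuous_src by metis
  then have "closedin ?P ?E"
    using Hausdorff compactin_imp_closedin Hausdorff_space_prod_topology by blast
  then have "openin ?P (topspace ?P - ?E)" by blast
  moreover have "(v, v) \<in> topspace ?P - ?E"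
    using iso v unit_in_arrows by (simp add: image_iff) metis
  ultimately obtain M N where MN: "openin (gtop G) M" "openin (gtop G) N" "v \<in> M" "v \<in> N"
    "M \<times> N \<subseteq> topspace ?P - ?E"
    unfolding openin_prod_topology_alt by meson
  show thesis
    using MN by (intro that[of "M \<inter> N"]) auto
qed

end

text \<open>A finite density argument: \<open>D\<close> is covered by finitely many bisections free
  of units, and for each of them \<open>U\<close> can be shrunk, still meeting \<open>V\<close>,
  until no isotropy arrow of that bisection starts in the part of \<open>V\<close> that is
  left.\<close>

lemma strongly_effective_unit_without_isotropy:
  assumes "ample_Hausdorff_groupoid G" and eff: "strongly_effective G"
    and V: "closedin (unit_top G) V" "invariant G V"
    and D: "compactin (gtop G) D" "openin (gtop G) D" "D \<inter> unit_space G = {}"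
    and U: "openin (gtop G) U" "V \<inter> U \<noteq> {}"
  obtains v where "v \<in> V \<inter> U" "\<And>b. b \<in> D \<Longrightarrow> \<not> (rng G b = v \<and> src G b = v)"
proof -
  interpret ample_Hausdorff_groupoid G by fact
  let ?GV = "{a \<in> arrows G. src G a \<in> V}"
  \<comment> \<open>This is effectiveness of the reduction to \<open>V\<close>; \<open>U(2)\<close>
    provides that \<open>V\<close> is nonempty.\<close>
  have int: "subtopology (gtop G) ?GV interior_of isotropy (restriction G V) = V"
    using eff V U(2) unfolding strongly_effective_def effective_def by (auto simp: restriction_def)
  have iso: "isotropy (restriction G V) = {a \<in> ?GV. rng G a = src G a}"
    by (auto simp: isotropy_def restriction_def)
  have VU: "V \<subseteq> unit_space G" using V(2) by (simp add: invariant_def)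
  have step: "\<exists>W. openin (gtop G) W \<and> W \<subseteq> U \<and> V \<inter> W \<noteq> {} \<and>
      (\<forall>b \<in> B. rng G b = src G b \<longrightarrow> src G b \<notin> V \<inter> W)"
    if B: "compact_open_bisection G B" "B \<inter> unit_space G = {}"
      and U: "openin (gtop G) U" "V \<inter> U \<noteq> {}" for B U
  proof -
    note B' = bisectionD[OF B(1)]
    let ?BU = "B \<inter> {a \<in> arrows G. src G a \<in> U}"
    have oBU: "openin (gtop G) ?BU" using B' U openin_src_vimage by blast
    show ?thesis
    proof (cases "\<exists>b \<in> ?BU. src G b \<in> V \<and> rng G b \<noteq> src G b")
      case True
      \<comment> \<open>\<open>src G\<close> is injective on \<open>B\<close>, so the source of an
        arrow of \<open>B\<close> with different ends is not the source of any isotropy arrow of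
        \<open>B\<close>. The sources of \<open>?N\<close> therefore form a suitable open
        set.\<close>
      let ?N = "?BU - {a \<in> arrows G. rng G a = src G a}"
      have "closedin (gtop G) {a \<in> arrows G. rng G a = src G a}"
        using closedin_continuous_maps_eq[OF Hausdorff continuous_rng continuous_src] .
      then have "openin (gtop G) (src G ` ?N)"
        using oBU open_map_src openin_diff by blast
      moreover have "src G ` ?N \<subseteq> U" "V \<inter> src G ` ?N \<noteq> {}"
        using True by auto
      moreover have "src G b \<notin> src G ` ?N" if "b \<in> B" "rng G b = src G b" for b
        using that B'(4,5) by (auto simp: inj_on_def)
      ultimately show ?thesis by blast
    next
      case False
      \<comment> \<open>Here the arrows of \<open>B\<close> over the part of \<open>V\<close> in
        \<open>U\<close> form an open subset of the reduction inside its isotropy. Effectiveness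
        makes them units, but \<open>B\<close> contains none, so there are no such arrows and
        \<open>U\<close> itself serves.\<close>
      have op: "openin (subtopology (gtop G) ?GV) (?BU \<inter> ?GV)"
        using oBU by (auto simp: openin_subtopology)
      have sub: "?BU \<inter> ?GV \<subseteq> isotropy (restriction G V)"
        unfolding iso using False by blast
      have "?BU \<inter> ?GV \<subseteq> V"
        using interior_of_maximal[OF sub op] unfolding int .
      then have "?BU \<inter> ?GV = {}" using B(2) VU by blast
      then show ?thesis using U B'(5) by blast
    qed
  qed
  have *: "\<exists>W. openin (gtop G) W \<and> W \<subseteq> U \<and> V \<inter> W \<noteq> {} \<and>
      (\<forall>b \<in> \<Union>\<B>. rng G b = src G b \<longrightarrow> src G b \<notin> V \<inter> W)"
    if "finite \<B>" "\<forall>B \<in> \<B>. compact_open_bisection G B \<and> B \<inter> unit_space G = {}" for \<B>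
    using that
  proof (induction \<B> rule: finite_induct)
    case empty
    then show ?case using U by auto
  next
    case (insert B \<B>)
    then obtain W where W: "openin (gtop G) W" "W \<subseteq> U" "V \<inter> W \<noteq> {}"
      "\<forall>b \<in> \<Union>\<B>. rng G b = src G b \<longrightarrow> src G b \<notin> V \<inter> W" by auto
    obtain W' where W': "openin (gtop G) W'" "W' \<subseteq> W" "V \<inter> W' \<noteq> {}"
      "\<forall>b \<in> B. rng G b = src G b \<longrightarrow> src G b \<notin> V \<inter> W'"
      using step[OF _ _ W(1,3), of B] insert.prems by auto
    show ?case using W W' by (intro exI[of _ W']) blast
  qed
  let ?C = "{B. compact_open_bisection G B \<and> B \<subseteq> D}"
  have "D \<subseteq> \<Union>?C"
    using ample_basis[OF D(2)] by blast
  moreover have "Ball ?C (openin (gtop G))" using bisectionD(1) by blast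
  ultimately obtain \<B> where \<B>: "finite \<B>" "\<B> \<subseteq> ?C" "D \<subseteq> \<Union>\<B>"
    using D(1) unfolding compactin_def Ball_def by meson
  obtain W where W: "W \<subseteq> U" "V \<inter> W \<noteq> {}"
    "\<forall>b \<in> \<Union>\<B>. rng G b = src G b \<longrightarrow> src G b \<notin> V \<inter> W"
    using *[OF \<B>(1)] \<B>(2) D(3) by blast
  then obtain v where v: "v \<in> V \<inter> W" by blast
  have "\<not> (rng G b = v \<and> src G b = v)" if "b \<in> D" for b
    using that v W(3) \<B>(3) by fastforce
  then show thesis using v W(1) by (intro that[of v]) blast+
qed

section \<open>The Steinberg algebra\<close>

locale steinberg = ample_Hausdorff_groupoid G + cring R
  for G :: "('g, 'n) groupoid_structure_scheme" and R :: "('r, 'm) ring_scheme" (structure)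
begin

abbreviation S :: "('g \<Rightarrow> 'r) set" where
  "S \<equiv> steinberg_carrier R G"

abbreviation A :: "('r, 'g \<Rightarrow> 'r) module" where
  "A \<equiv> steinberg_algebra R G"

abbreviation conv :: "('g \<Rightarrow> 'r) \<Rightarrow> ('g \<Rightarrow> 'r) \<Rightarrow> 'g \<Rightarrow> 'r" where
  "conv \<equiv> convolution R G"

abbreviation supp :: "('g \<Rightarrow> 'r) \<Rightarrow> 'g set" where
  "supp f \<equiv> {a \<in> arrows G. f a \<noteq> \<zero>}"

text \<open>The generator c 1_B of the span, with the scalar built into the conditional;
  \<open>smult_char_fun\<close> links it to the form used in the theorem.\<close>

definition step_fun :: "'r \<Rightarrow> 'g set \<Rightarrow> 'g \<Rightarrow> 'r" where
  "step_fun c B = (\<lambda>a \<in> arrows G. if a \<in> B then c else \<zero>)"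

lemma step_fun_apply: "a \<in> arrows G \<Longrightarrow> step_fun c B a = (if a \<in> B then c else \<zero>)"
  by (simp add: step_fun_def)

lemma steinberg_simps [simp]:
  "carrier A = S" "mult A = conv" "zero A = (\<lambda>a \<in> arrows G. \<zero>)"
  "add A = (\<lambda>f g. \<lambda>a \<in> arrows G. f a \<oplus> g a)" "smult A = (\<lambda>c f. \<lambda>a \<in> arrows G. c \<otimes> f a)"
  by (simp_all add: steinberg_algebra_def)

lemma smult_char_fun: "c \<in> carrier R \<Longrightarrow> c \<odot>\<^bsub>A\<^esub> char_fun R G B = step_fun c B"
  by (auto simp: step_fun_def char_fun_def)

lemma steinberg_mem: "\<lbrakk>f \<in> S; a \<in> arrows G\<rbrakk> \<Longrightarrow> f a \<in> carrier R"
  by (auto simp: steinberg_carrier_def)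

lemma steinberg_ext: "\<lbrakk>f \<in> S; g \<in> S; \<And>a. a \<in> arrows G \<Longrightarrow> f a = g a\<rbrakk> \<Longrightarrow> f = g"
  unfolding steinberg_carrier_def by (blast intro: PiE_ext)

lemma steinberg_restrict: "f \<in> S \<Longrightarrow> restrict f (arrows G) = f"
  by (auto simp: steinberg_carrier_def)

lemma steinberg_local:
  assumes "f \<in> S" "a \<in> arrows G"
  obtains U where "openin (gtop G) U" "a \<in> U" "\<And>b. b \<in> U \<Longrightarrow> f b = f a"
  using assms unfolding steinberg_carrier_def by blast

text \<open>Assumes local constancy instead of membership in \<open>S\<close>, so that it is
  available while membership is still being proved.\<close>

lemma locally_constant_level_open:
  assumes "\<And>a. a \<in> arrows G \<Longrightarrow> \<exists>U. openin (gtop G) U \<and> a \<in> U \<and> (\<forall>b \<in> U. f b = f a)"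
  shows "openin (gtop G) {a \<in> arrows G. P (f a)}"
proof (subst openin_subopen, intro ballI)
  fix a assume a: "a \<in> {a \<in> arrows G. P (f a)}"
  then obtain U where "openin (gtop G) U" "a \<in> U" "\<forall>b \<in> U. f b = f a"
    using assms by blast
  moreover have "U \<subseteq> {a \<in> arrows G. P (f a)}"
  proof
    fix b assume "b \<in> U"
    then have "f b = f a" "b \<in> arrows G"
      using \<open>\<forall>b \<in> U. f b = f a\<close> openin_subset[OF \<open>openin (gtop G) U\<close>] by blast+
    then show "b \<in> {a \<in> arrows G. P (f a)}" using a by simp
  qed
  ultimately show "\<exists>T. openin (gtop G) T \<and> a \<in> T \<and> T \<subseteq> {a \<in> arrows G. P (f a)}"
    by blast
qed

lemma locally_constant_level_closed:
  assumes "\<And>a. a \<in> arrows G \<Longrightarrow> \<exists>U. openin (gtop G) U \<and> a \<in> U \<and> (\<forall>b \<in> U. f b = f a)"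
  shows "closedin (gtop G) {a \<in> arrows G. P (f a)}"
proof -
  have "arrows G - {a \<in> arrows G. P (f a)} = {a \<in> arrows G. \<not> P (f a)}" by blast
  then show ?thesis
    using locally_constant_level_open[OF assms, of "\<lambda>x. \<not> P x"] by (simp add: closedin_def)
qed

lemma level_open: "f \<in> S \<Longrightarrow> openin (gtop G) {a \<in> arrows G. P (f a)}"
  and level_closed: "f \<in> S \<Longrightarrow> closedin (gtop G) {a \<in> arrows G. P (f a)}"
  by (rule locally_constant_level_open locally_constant_level_closed,
      simp add: steinberg_carrier_def)+

lemma supp_compact: "f \<in> S \<Longrightarrow> compactin (gtop G) (supp f)"
  using level_closed[of f "\<lambda>x. x \<noteq> \<zero>"]
  by (simp add: steinberg_carrier_def closure_of_closedin)

text \<open>The support of a locally constant function is closed, so any compact set around it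
  suffices. For sums and products such a bound is at hand, while the exact support depends on
  cancellation.\<close>

lemma steinbergI:
  assumes "f \<in> arrows G \<rightarrow>\<^sub>E carrier R"
    and "\<And>a. a \<in> arrows G \<Longrightarrow> \<exists>U. openin (gtop G) U \<and> a \<in> U \<and> (\<forall>b \<in> U. f b = f a)"
    and "compactin (gtop G) C" "supp f \<subseteq> C"
  shows "f \<in> S"
proof -
  have "closedin (gtop G) (supp f)"
    using assms(2) by (rule locally_constant_level_closed)
  then have "compactin (gtop G) (gtop G closure_of supp f)"
    using assms(3,4) closed_compactin by (simp add: closure_of_closedin)
  with assms show ?thesis by (simp add: steinberg_carrier_def)
qed

text \<open>One argument for sums, negatives and scalar multiples;
  \<open>h \<zero> \<zero> = \<zero>\<close> keeps the support inside the union of the two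
  supports.\<close>

lemma pointwise_closed:
  assumes f: "f \<in> S" and g: "g \<in> S"
    and h: "\<And>x y. \<lbrakk>x \<in> carrier R; y \<in> carrier R\<rbrakk> \<Longrightarrow> h x y \<in> carrier R" "h \<zero> \<zero> = \<zero>"
  shows "(\<lambda>a \<in> arrows G. h (f a) (g a)) \<in> S"
proof (rule steinbergI)
  show "(\<lambda>a \<in> arrows G. h (f a) (g a)) \<in> arrows G \<rightarrow>\<^sub>E carrier R"
    using f g h steinberg_mem by simp
  show "compactin (gtop G) (supp f \<union> supp g)"
    using f g supp_compact compactin_Un by blast
  show "supp (\<lambda>a \<in> arrows G. h (f a) (g a)) \<subseteq> supp f \<union> supp g"
    using h(2) by auto
  fix a assume a: "a \<in> arrows G"
  obtain U where U: "openin (gtop G) U" "a \<in> U" "\<And>b. b \<in> U \<Longrightarrow> f b = f a"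
    using steinberg_local[OF f a] by blast
  obtain V where V: "openin (gtop G) V" "a \<in> V" "\<And>b. b \<in> V \<Longrightarrow> g b = g a"
    using steinberg_local[OF g a] by blast
  have "(\<lambda>a \<in> arrows G. h (f a) (g a)) b = (\<lambda>a \<in> arrows G. h (f a) (g a)) a" if "b \<in> U \<inter> V" for b
    using that a openin_subset[OF U(1)] U(3)[of b] V(3)[of b] by auto
  then show "\<exists>U. openin (gtop G) U \<and> a \<in> U \<and>
      (\<forall>b \<in> U. (\<lambda>a \<in> arrows G. h (f a) (g a)) b = (\<lambda>a \<in> arrows G. h (f a) (g a)) a)"
    using U(1,2) V(1,2) by (intro exI[of _ "U \<inter> V"]) blast
qed

lemma step_fun_closed:
  assumes c: "c \<in> carrier R" and B: "compact_open_bisection G B"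
  shows "step_fun c B \<in> S"
proof (rule steinbergI)
  note B' = bisectionD[OF B] closed_bisection[OF B]
  show "step_fun c B \<in> arrows G \<rightarrow>\<^sub>E carrier R"
    using c by (simp add: step_fun_def)
  show "compactin (gtop G) B" by (rule B')
  show "supp (step_fun c B) \<subseteq> B" by (auto simp: step_fun_def)
  fix a assume a: "a \<in> arrows G"
  show "\<exists>U. openin (gtop G) U \<and> a \<in> U \<and> (\<forall>b \<in> U. step_fun c B b = step_fun c B a)"
  proof (cases "a \<in> B")
    case True
    then show ?thesis using B' by (intro exI[of _ B]) (auto simp: step_fun_def)
  next
    case False
    then show ?thesis using B' a
      by (intro exI[of _ "arrows G - B"]) (auto simp: step_fun_def)
  qed
qed

lemma zero_closed: "(\<lambda>a \<in> arrows G. \<zero>) \<in> S"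
  by (rule steinbergI[of _ "{}"]) auto

lemma add_closed: "\<lbrakk>f \<in> S; g \<in> S\<rbrakk> \<Longrightarrow> (\<lambda>a \<in> arrows G. f a \<oplus> g a) \<in> S"
  by (rule pointwise_closed) auto

lemma neg_closed: "f \<in> S \<Longrightarrow> (\<lambda>a \<in> arrows G. \<ominus> f a) \<in> S"
  using pointwise_closed[of f f "\<lambda>x y. \<ominus> x"] by simp

lemma smult_closed: "\<lbrakk>c \<in> carrier R; f \<in> S\<rbrakk> \<Longrightarrow> (\<lambda>a \<in> arrows G. c \<otimes> f a) \<in> S"
  using pointwise_closed[of f f "\<lambda>x y. c \<otimes> x"] by simp

lemma zero_add: "f \<in> S \<Longrightarrow> (\<lambda>a \<in> arrows G. (\<lambda>a \<in> arrows G. \<zero>) a \<oplus> f a) = f"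
  by (rule steinberg_ext[OF add_closed[OF zero_closed]]) (auto simp: steinberg_mem)

lemma abelian_group_steinberg: "abelian_group A"
proof (rule abelian_groupI)
  fix f assume f: "f \<in> carrier A"
  then show "\<exists>g \<in> carrier A. g \<oplus>\<^bsub>A\<^esub> f = \<zero>\<^bsub>A\<^esub>"
    using neg_closed by (intro bexI[of _ "\<lambda>a \<in> arrows G. \<ominus> f a"])
      (auto simp: l_neg steinberg_mem intro!: restrict_ext)
next
  fix f assume "f \<in> carrier A"
  then show "\<zero>\<^bsub>A\<^esub> \<oplus>\<^bsub>A\<^esub> f = f" using zero_add by simp
qed (auto simp: zero_closed add_closed a_ac steinberg_mem intro!: restrict_ext)

lemma steinberg_a_inv:
  assumes "f \<in> S"
  shows "\<ominus>\<^bsub>A\<^esub> f = (\<lambda>a \<in> arrows G. \<ominus> f a)"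
proof -
  interpret A: abelian_group A by (rule abelian_group_steinberg)
  show ?thesis
    using assms neg_closed
    by (intro A.minus_equality) (auto simp: l_neg steinberg_mem intro!: restrict_ext)
qed

text \<open>Disjointifying a finite cover of the support by compact open bisections writes \<open>f\<close> as a sum
  of multiples of characteristic functions of small bisections.\<close>

lemma steinberg_induct:
  assumes f: "f \<in> S"
    and zero: "(\<lambda>a \<in> arrows G. \<zero>) \<in> N"
    and add: "\<And>g h. \<lbrakk>g \<in> N; h \<in> N\<rbrakk> \<Longrightarrow> (\<lambda>a \<in> arrows G. g a \<oplus> h a) \<in> N"
    and local: "\<And>a. \<lbrakk>a \<in> arrows G; f a \<noteq> \<zero>\<rbrakk> \<Longrightarrow> \<exists>U. openin (gtop G) U \<and> a \<in> U \<and>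
      (\<forall>B. compact_open_bisection G B \<and> B \<subseteq> U \<and> (\<forall>b \<in> B. f b = f a) \<longrightarrow> step_fun (f a) B \<in> N)"
  shows "f \<in> N"
proof -
  \<comment> \<open>Membership of the step functions is demanded for every smaller bisection
    \<open>C\<close> too, because disjointifying the cover replaces its members by
    differences.\<close>
  define \<B> where "\<B> = {B. compact_open_bisection G B \<and>
    (\<exists>c \<in> carrier R. (\<forall>b \<in> B. f b = c) \<and>
      (\<forall>C. compact_open_bisection G C \<and> C \<subseteq> B \<longrightarrow> step_fun c C \<in> N))}"
  have cover: "supp f \<subseteq> \<Union>\<B>"
  proof
    fix a assume "a \<in> supp f"
    then have a: "a \<in> arrows G" "f a \<noteq> \<zero>" by auto
    obtain U where U: "openin (gtop G) U" "a \<in> U"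
      "\<And>B. \<lbrakk>compact_open_bisection G B; B \<subseteq> U; \<forall>b \<in> B. f b = f a\<rbrakk> \<Longrightarrow> step_fun (f a) B \<in> N"
      using local[OF a] by blast
    have "openin (gtop G) (U \<inter> {b \<in> arrows G. f b = f a})"
      using U(1) level_open[OF f, of "\<lambda>x. x = f a"] by blast
    then obtain B where B: "compact_open_bisection G B" "a \<in> B"
      "B \<subseteq> U \<inter> {b \<in> arrows G. f b = f a}"
      using ample_basis[of "U \<inter> {b \<in> arrows G. f b = f a}" a] U(2) a by blast
    have "step_fun (f a) C \<in> N" if "compact_open_bisection G C" "C \<subseteq> B" for C
      using that B by (intro U(3)) auto
    then have "B \<in> \<B>"
      unfolding \<B>_def using B a steinberg_mem[OF f] by blast
    with B(2) show "a \<in> \<Union>\<B>" by blast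
  qed
  have "Ball \<B> (openin (gtop G))" using bisectionD(1) by (auto simp: \<B>_def)
  then obtain \<F> where \<F>: "finite \<F>" "\<F> \<subseteq> \<B>" "supp f \<subseteq> \<Union>\<F>"
    using supp_compact[OF f] cover unfolding compactin_def Ball_def by meson
  have "(\<lambda>a \<in> arrows G. if a \<in> \<Union>\<F> then f a else \<zero>) \<in> N"
    using \<F>(1,2)
  proof (induction \<F> rule: finite_induct)
    case empty
    then show ?case using zero by (simp add: restrict_def)
  next
    case (insert B \<F>)
    \<comment> \<open>The part of \<open>B\<close> not yet covered. It is disjoint from the earlier
      bisections, so adding its step function extends the partial restriction of \<open>f\<close>
      without changing values already fixed.\<close>
    let ?C = "B - \<Union>\<F>"
    have "B \<in> \<B>" using insert.prems by blast
    then obtain c where B: "compact_open_bisection G B" and c: "c \<in> carrier R" "\<forall>b \<in> B. f b = c"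
      "\<forall>C. compact_open_bisection G C \<and> C \<subseteq> B \<longrightarrow> step_fun c C \<in> N"
      unfolding \<B>_def by auto
    have "openin (gtop G) (\<Union>\<F>)" "closedin (gtop G) (\<Union>\<F>)"
      using insert.hyps insert.prems bisectionD(1) closed_bisection
      by (auto simp: \<B>_def intro!: openin_Union closedin_Union)
    then have "compact_open_bisection G ?C"
      using B bisectionD(1)[OF B] closed_bisection[OF B]
      by (intro bisection_subset[OF B]) auto
    then have "step_fun c ?C \<in> N" using c(3) by blast
    from add[OF this insert.IH] insert.prems
    have "(\<lambda>a \<in> arrows G. step_fun c ?C a \<oplus> (\<lambda>a \<in> arrows G. if a \<in> \<Union>\<F> then f a else \<zero>) a) \<in> N"
      by blast
    moreover have "(\<lambda>a \<in> arrows G. step_fun c ?C a \<oplus> (\<lambda>a \<in> arrows G. if a \<in> \<Union>\<F> then f a else \<zero>) a)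
        = (\<lambda>a \<in> arrows G. if a \<in> \<Union>(insert B \<F>) then f a else \<zero>)"
      using c(1,2) steinberg_mem[OF f] by (intro restrict_ext) (auto simp: step_fun_def)
    ultimately show ?case by (simp only:)
  qed
  moreover have "(\<lambda>a \<in> arrows G. if a \<in> \<Union>\<F> then f a else \<zero>) = restrict f (arrows G)"
    using \<F>(3) by (intro restrict_ext) auto
  ultimately show ?thesis using steinberg_restrict[OF f] by simp
qed

section \<open>Convolution: finiteness, products with bisections, closure\<close>

lemma finite_fibre:
  assumes "f \<in> S"
  shows "finite {b \<in> arrows G. rng G b = u \<and> f b \<noteq> \<zero>}"
proof -
  let ?F = "\<lambda>f. {b \<in> arrows G. rng G b = u \<and> f b \<noteq> \<zero>}"
  have "f \<in> {f. finite (?F f)}"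
  proof (rule steinberg_induct[OF assms])
    fix g h assume "g \<in> {f. finite (?F f)}" "h \<in> {f. finite (?F f)}"
    then have "finite (?F g \<union> ?F h)" by simp
    then show "(\<lambda>a \<in> arrows G. g a \<oplus> h a) \<in> {f. finite (?F f)}"
      unfolding mem_Collect_eq by (rule finite_subset[rotated]) auto
  next
    have "finite (?F (step_fun c B))" if B: "compact_open_bisection G B" for c B
    proof -
      \<comment> \<open>A bisection meets each fibre of the range map at most once.\<close>
      have "inj_on (rng G) (?F (step_fun c B))"
        using bisectionD(3)[OF B] by (rule inj_on_subset) (auto simp: step_fun_def)
      moreover have "finite (rng G ` ?F (step_fun c B))"
        by (rule finite_subset[of _ "{u}"]) auto
      ultimately show ?thesis using finite_imageD by blast
    qed
    then show "\<exists>U. openin (gtop G) U \<and> a \<in> U \<and> (\<forall>B. compact_open_bisection G B \<and> B \<subseteq> U \<and>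
        (\<forall>b \<in> B. f b = f a) \<longrightarrow> step_fun (f a) B \<in> {f. finite (?F f)})" if "a \<in> arrows G" for a
      using that by (intro exI[of _ "arrows G"]) auto
  qed simp
  then show ?thesis by simp
qed

text \<open>The index set in \<open>convolution\<close> depends on both functions. Here any finite
  subset of the range fibre containing the support of \<open>f\<close> there may replace it, so that
  several convolutions can be summed over a common set.\<close>

lemma conv_eq_finsum:
  assumes f: "f \<in> S" and g: "g \<in> S" and c: "c \<in> arrows G" and T: "finite T"
    "{b \<in> arrows G. rng G b = rng G c \<and> f b \<noteq> \<zero>} \<subseteq> T" "T \<subseteq> {b \<in> arrows G. rng G b = rng G c}"
  shows "conv f g c = (\<Oplus>b \<in> T. f b \<otimes> g (cmp G (ginv G b) c))"
proof -
  have in_c: "f b \<in> carrier R" "g (cmp G (ginv G b) c) \<in> carrier R"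
    if "b \<in> arrows G" "rng G b = rng G c" for b
    using that f g c cmp_closed[of "ginv G b" c] by (simp_all add: steinberg_mem ginv_in src_ginv)
  show ?thesis
    unfolding convolution_def restrict_apply'[OF c]
  proof (rule add.finprod_mono_neutral_cong_left[OF T(1)])
    show "{b \<in> arrows G. rng G b = rng G c \<and> f b \<otimes> g (cmp G (ginv G b) c) \<noteq> \<zero>} \<subseteq> T"
      using T(2) in_c(2) by auto
    show "(\<lambda>b. f b \<otimes> g (cmp G (ginv G b) c)) \<in> T \<rightarrow> carrier R"
      using T(3) in_c by auto
  qed (use T(3) in auto)
qed

lemma conv_single:
  assumes c: "c \<in> arrows G" and b: "b \<in> arrows G" "rng G b = rng G c"
    and carr: "f b \<otimes> g (cmp G (ginv G b) c) \<in> carrier R"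
    and zero: "\<And>e. \<lbrakk>e \<in> arrows G; rng G e = rng G c; e \<noteq> b\<rbrakk> \<Longrightarrow> f e \<otimes> g (cmp G (ginv G e) c) = \<zero>"
  shows "conv f g c = f b \<otimes> g (cmp G (ginv G b) c)"
proof -
  have "conv f g c = (\<Oplus>e \<in> {b}. f e \<otimes> g (cmp G (ginv G e) c))"
    unfolding convolution_def restrict_apply'[OF c]
    by (rule add.finprod_mono_neutral_cong_left) (use b zero carr in auto)
  also have "\<dots> = f b \<otimes> g (cmp G (ginv G b) c)"
    using carr by simp
  finally show ?thesis .
qed

text \<open>Evaluation takes place at a product \<open>cmp G b d\<close> because its range
  determines \<open>b\<close> within \<open>B\<close>: all other terms of the sum vanish.\<close>

lemma conv_bisection_left:
  assumes "f \<in> S" "compact_open_bisection G B" "c \<in> carrier R"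
    and b: "b \<in> B" and d: "d \<in> arrows G" "src G b = rng G d"
  shows "conv (step_fun c B) f (cmp G b d) = c \<otimes> f d"
proof -
  note B = bisectionD[OF assms(2)]
  have b': "b \<in> arrows G" using b B(5) by blast
  have "conv (step_fun c B) f (cmp G b d) = step_fun c B b \<otimes> f (cmp G (ginv G b) (cmp G b d))"
  proof (rule conv_single)
    fix e assume e: "e \<in> arrows G" "rng G e = rng G (cmp G b d)" "e \<noteq> b"
    then have "e \<notin> B"
      using b b' d B(3) by (auto simp: inj_on_def cmp_closed)
    moreover have "cmp G (ginv G e) (cmp G b d) \<in> arrows G"
      using e b' d by (intro cmp_closed) (auto simp: cmp_closed ginv_in src_ginv)
    ultimately show "step_fun c B e \<otimes> f (cmp G (ginv G e) (cmp G b d)) = \<zero>"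
      using e(1) steinberg_mem[OF assms(1)] by (simp add: step_fun_apply)
  qed (use assms b' in \<open>auto simp: cmp_closed ginv_cmp_cancel steinberg_mem step_fun_apply\<close>)
  then show ?thesis using b b' d by (simp add: ginv_cmp_cancel step_fun_apply)
qed

text \<open>The sum runs over left factors \<open>e\<close>, so \<open>B\<close> constrains the
  remaining right factor. That factor has the source of \<open>b\<close>; if it lies in
  \<open>B\<close> it equals \<open>b\<close>, and cancelling \<open>b\<close> gives
  \<open>e = d\<close>.\<close>

lemma conv_bisection_right:
  assumes "f \<in> S" "compact_open_bisection G B" "c \<in> carrier R"
    and b: "b \<in> B" and d: "d \<in> arrows G" "src G d = rng G b"
  shows "conv f (step_fun c B) (cmp G d b) = f d \<otimes> c"
proof -
  note B = bisectionD[OF assms(2)]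
  have b': "b \<in> arrows G" using b B(5) by blast
  have "conv f (step_fun c B) (cmp G d b) = f d \<otimes> step_fun c B (cmp G (ginv G d) (cmp G d b))"
  proof (rule conv_single)
    fix e assume e: "e \<in> arrows G" "rng G e = rng G (cmp G d b)" "e \<noteq> d"
    let ?x = "cmp G (ginv G e) (cmp G d b)"
    have x: "?x \<in> arrows G" "src G ?x = src G b"
      using e b' d by (simp_all add: cmp_closed ginv_in src_ginv)
    have "?x \<notin> B"
    proof
      assume "?x \<in> B"
      then have "?x = b" using B(4) b x by (auto simp: inj_on_def)
      then have "cmp G e b = cmp G d b" "src G e = rng G b"
        using e b' d cmp_ginv_cancel[of e "cmp G d b"] cmp_closed(2)[of "ginv G e" "cmp G d b"]
        by (auto simp: cmp_closed ginv_in src_ginv rng_ginv)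
      then show False using cmp_cmp_ginv[of e b] cmp_cmp_ginv[of d b] e b' d by auto
    qed
    then show "f e \<otimes> step_fun c B ?x = \<zero>"
      using e(1) x steinberg_mem[OF assms(1)] by (simp add: step_fun_apply)
  qed (use assms b' in \<open>auto simp: cmp_closed ginv_cmp_cancel steinberg_mem step_fun_apply\<close>)
  then show ?thesis using b b' d by (simp add: ginv_cmp_cancel step_fun_apply)
qed

lemma conv_bisection_left_zero:
  assumes "f \<in> S" "a \<in> arrows G" "rng G a \<notin> rng G ` B"
  shows "conv (step_fun c B) f a = \<zero>"
proof -
  have "step_fun c B b \<otimes> f (cmp G (ginv G b) a) = \<zero>" if "b \<in> arrows G" "rng G b = rng G a" for b
  proof -
    have "b \<notin> B" using that(2)[symmetric] assms(3) by auto
    then show ?thesis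
      using that assms cmp_closed[of "ginv G b" a]
      by (simp add: step_fun_apply steinberg_mem ginv_in src_ginv)
  qed
  then show ?thesis
    unfolding convolution_def restrict_apply'[OF assms(2)] by (intro add.finprod_one_eqI) auto
qed

text \<open>Left multiplication by c 1_K cuts \<open>f\<close> down by range and scales it;
  \<open>conv_units_right\<close> does the same by source. With \<open>c = \<one>\<close> these are
  the local identities.\<close>

lemma conv_units_left:
  assumes "f \<in> S" "compact_open_bisection G K" "K \<subseteq> unit_space G" "c \<in> carrier R" "a \<in> arrows G"
  shows "conv (step_fun c K) f a = (if rng G a \<in> K then c \<otimes> f a else \<zero>)"
proof (cases "rng G a \<in> K")
  case True
  then show ?thesis
    using conv_bisection_left[OF assms(1,2,4) True assms(5)] assms(5)
    by (simp add: src_unit rng_in cmp_rng)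
next
  case False
  then have "rng G a \<notin> rng G ` K"
    using assms(3) rng_unit by force
  with False show ?thesis using conv_bisection_left_zero assms by simp
qed

lemma conv_units_right:
  assumes "f \<in> S" "compact_open_bisection G K" "K \<subseteq> unit_space G" "c \<in> carrier R" "a \<in> arrows G"
  shows "conv f (step_fun c K) a = (if src G a \<in> K then f a \<otimes> c else \<zero>)"
proof (cases "src G a \<in> K")
  case True
  then show ?thesis
    using conv_bisection_right[OF assms(1,2,4) True assms(5)] assms(5)
    by (simp add: rng_unit src_in cmp_src)
next
  case False
  have "f b \<otimes> step_fun c K (cmp G (ginv G b) a) = \<zero>" if b: "b \<in> arrows G" "rng G b = rng G a" for b
  proof -
    have x: "cmp G (ginv G b) a \<in> arrows G" "src G (cmp G (ginv G b) a) = src G a"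
      using b assms(5) cmp_closed[of "ginv G b" a] by (simp_all add: ginv_in src_ginv)
    then have "cmp G (ginv G b) a \<notin> K"
      using False assms(3) src_unit by (metis subsetD)
    then show ?thesis using x b assms(1) by (simp add: step_fun_apply steinberg_mem)
  qed
  then have "conv f (step_fun c K) a = \<zero>"
    unfolding convolution_def restrict_apply'[OF assms(5)] by (intro add.finprod_one_eqI) auto
  with False show ?thesis by simp
qed

lemma conv_outside: "a \<notin> arrows G \<Longrightarrow> conv f g a = undefined"
  by (simp add: convolution_def)

lemma conv_eqI:
  assumes "\<And>c. c \<in> arrows G \<Longrightarrow> conv f g c = h c"
  shows "conv f g = (\<lambda>c \<in> arrows G. h c)"
  using assms by (intro ext) (simp add: restrict_def conv_outside)

lemma conv_zero_left:
  assumes "g \<in> S"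
  shows "conv (\<lambda>a \<in> arrows G. \<zero>) g = (\<lambda>a \<in> arrows G. \<zero>)"
proof -
  have "conv (\<lambda>a \<in> arrows G. \<zero>) g c = \<zero>" if "c \<in> arrows G" for c
    using conv_eq_finsum[OF zero_closed assms that, of "{}"] by simp
  then show ?thesis by (rule conv_eqI)
qed

lemma conv_add_left:
  assumes f: "f \<in> S" and g: "g \<in> S" and h: "h \<in> S"
  shows "conv (\<lambda>a \<in> arrows G. f a \<oplus> g a) h = (\<lambda>a \<in> arrows G. conv f h a \<oplus> conv g h a)"
proof -
  have "conv (\<lambda>a \<in> arrows G. f a \<oplus> g a) h c = conv f h c \<oplus> conv g h c" if c: "c \<in> arrows G" for c
  proof -
    let ?F = "\<lambda>f. {b \<in> arrows G. rng G b = rng G c \<and> f b \<noteq> \<zero>}"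
    let ?T = "?F f \<union> ?F g"
    have T: "finite ?T" "?F (\<lambda>a \<in> arrows G. f a \<oplus> g a) \<subseteq> ?T" "?T \<subseteq> {b \<in> arrows G. rng G b = rng G c}"
      using finite_fibre f g by auto
    have hc: "h (cmp G (ginv G b) c) \<in> carrier R" if "b \<in> ?T" for b
      using that c h cmp_closed[of "ginv G b" c] by (auto simp: steinberg_mem ginv_in src_ginv)
    have "conv (\<lambda>a \<in> arrows G. f a \<oplus> g a) h c =
        (\<Oplus>b \<in> ?T. (\<lambda>a \<in> arrows G. f a \<oplus> g a) b \<otimes> h (cmp G (ginv G b) c))"
      using T by (intro conv_eq_finsum add_closed f g h c)
    also have "\<dots> = (\<Oplus>b \<in> ?T. f b \<otimes> h (cmp G (ginv G b) c) \<oplus> g b \<otimes> h (cmp G (ginv G b) c))"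
      using f g hc by (intro finsum_cong') (auto simp: steinberg_mem l_distr)
    also have "\<dots> = (\<Oplus>b \<in> ?T. f b \<otimes> h (cmp G (ginv G b) c)) \<oplus> (\<Oplus>b \<in> ?T. g b \<otimes> h (cmp G (ginv G b) c))"
      using f g hc by (intro finsum_addf) (auto simp: steinberg_mem)
    also have "\<dots> = conv f h c \<oplus> conv g h c"
      using T conv_eq_finsum[OF f h c, of ?T] conv_eq_finsum[OF g h c, of ?T] by simp
    finally show ?thesis .
  qed
  then show ?thesis by (rule conv_eqI)
qed

text \<open>Over the range of \<open>B\<close> the value at \<open>a\<close> is \<open>c\<close>
  times the value of \<open>g\<close> at \<open>cmp G (ginv G b) a\<close>, where \<open>b\<close>
  is the arrow of \<open>B\<close> with the range of \<open>a\<close>. Local constancy holds since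
  \<open>b\<close> depends continuously on \<open>a\<close>; elsewhere the product is zero.\<close>

lemma conv_step_fun_closed:
  assumes g: "g \<in> S" and B: "compact_open_bisection G B" and c: "c \<in> carrier R"
  shows "conv (step_fun c B) g \<in> S"
proof (rule steinbergI)
  note B' = bisectionD[OF B]
  have val: "\<exists>b d. b \<in> B \<and> d \<in> arrows G \<and> src G b = rng G d \<and> a = cmp G b d \<and> d = cmp G (ginv G b) a
      \<and> rng G b = rng G a \<and> conv (step_fun c B) g a = c \<otimes> g d"
    if a: "a \<in> arrows G" and r: "rng G a \<in> rng G ` B" for a
  proof -
    obtain b where b: "b \<in> B" "rng G b = rng G a" using r by force
    let ?d = "cmp G (ginv G b) a"
    have b': "b \<in> arrows G" using b B'(5) by blast
    have d: "?d \<in> arrows G" "src G b = rng G ?d" "cmp G b ?d = a"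
      using a b b' by (simp_all add: cmp_closed ginv_in src_ginv rng_ginv cmp_ginv_cancel)
    then show ?thesis
      using b conv_bisection_left[OF g B c b(1) d(1,2)] by (intro exI[of _ b] exI[of _ ?d]) simp
  qed
  show "conv (step_fun c B) g \<in> arrows G \<rightarrow>\<^sub>E carrier R"
  proof (rule PiE_I)
    fix a assume a: "a \<in> arrows G"
    show "conv (step_fun c B) g a \<in> carrier R"
      using val[OF a] conv_bisection_left_zero[OF g a, of B c] c g steinberg_mem
      by (cases "rng G a \<in> rng G ` B") auto
  qed (simp add: convolution_def)
  show "compactin (gtop G) ((\<lambda>(a, b). cmp G a b) ` (B \<times> supp g \<inter> composable G))"
    using compact_product B'(2) supp_compact[OF g] by blast
  show "supp (conv (step_fun c B) g) \<subseteq> (\<lambda>(a, b). cmp G a b) ` (B \<times> supp g \<inter> composable G)"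
  proof
    fix a assume "a \<in> supp (conv (step_fun c B) g)"
    then have a: "a \<in> arrows G" "conv (step_fun c B) g a \<noteq> \<zero>" by auto
    then have "rng G a \<in> rng G ` B" using conv_bisection_left_zero[OF g] by blast
    from val[OF a(1) this] obtain b d where "b \<in> B" "d \<in> arrows G" "src G b = rng G d" "a = cmp G b d"
      "conv (step_fun c B) g a = c \<otimes> g d" by blast
    moreover from this have "g d \<noteq> \<zero>" using a(2) c by auto
    ultimately have "(b, d) \<in> B \<times> supp g \<inter> composable G"
      using B'(5) by (auto simp: composable_iff)
    then show "a \<in> (\<lambda>(a, b). cmp G a b) ` (B \<times> supp g \<inter> composable G)"
      using \<open>a = cmp G b d\<close> by force
  qed
  fix a assume a: "a \<in> arrows G"
  show "\<exists>U. openin (gtop G) U \<and> a \<in> U \<and>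
      (\<forall>x \<in> U. conv (step_fun c B) g x = conv (step_fun c B) g a)"
  proof (cases "rng G a \<in> rng G ` B")
    case False
    \<comment> \<open>Compactness of \<open>B\<close> makes its range closed, so the product
      vanishes on a whole neighbourhood of \<open>a\<close>.\<close>
    have "closedin (gtop G) (rng G ` B)"
      using B'(2) continuous_rng image_compactin compactin_imp_closedin Hausdorff by blast
    then have "openin (gtop G) {x \<in> arrows G. rng G x \<in> arrows G - rng G ` B}"
      by (intro openin_rng_vimage) blast
    moreover have "conv (step_fun c B) g x = conv (step_fun c B) g a"
      if "x \<in> {x \<in> arrows G. rng G x \<in> arrows G - rng G ` B}" for x
      using that False a conv_bisection_left_zero[OF g, of x B c]
        conv_bisection_left_zero[OF g, of a B c] by simp
    moreover have "a \<in> {x \<in> arrows G. rng G x \<in> arrows G - rng G ` B}"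
      using False a rng_in unit_in_arrows by blast
    ultimately show ?thesis by blast
  next
    case True
    from val[OF a this] obtain b d where b: "b \<in> B" and d: "d \<in> arrows G" "src G b = rng G d"
      "a = cmp G b d" "d = cmp G (ginv G b) a" "rng G b = rng G a"
      "conv (step_fun c B) g a = c \<otimes> g d" by blast
    obtain D where D: "openin (gtop G) D" "d \<in> D" "\<And>x. x \<in> D \<Longrightarrow> g x = g d"
      using steinberg_local[OF g d(1)] by blast
    have "(ginv G b, a) \<in> composable G"
      using a b d(5) B'(5) by (auto simp: composable_iff ginv_in src_ginv)
    then obtain M N where MN: "openin (gtop G) M" "openin (gtop G) N" "ginv G b \<in> M" "a \<in> N"
      "\<And>x y. \<lbrakk>x \<in> M; y \<in> N; (x, y) \<in> composable G\<rbrakk> \<Longrightarrow> cmp G x y \<in> D"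
      using cmp_nbhd D(1,2) d(4) by metis
    \<comment> \<open>\<open>P\<close> consists of the arrows of \<open>B\<close> whose inverse
      stays in \<open>M\<close>. Its range is open, so for \<open>x\<close> in \<open>U\<close> the
      arrow of \<open>B\<close> matching \<open>x\<close> can be taken from \<open>P\<close>, and
      its inverse composed with \<open>x\<close> falls into \<open>D\<close>, where \<open>g\<close>
      is constant.\<close>
    define P where "P = B \<inter> {x \<in> arrows G. ginv G x \<in> M}"
    define U where "U = N \<inter> {x \<in> arrows G. rng G x \<in> rng G ` P}"
    have "openin (gtop G) P" unfolding P_def using B'(1) MN(1) openin_ginv_vimage by blast
    then have oU: "openin (gtop G) U"
      unfolding U_def using MN(2) openin_rng_vimage open_map_rng by blast
    have "b \<in> P" using b B'(5) MN(3) by (auto simp: P_def)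
    then have aU: "a \<in> U" using a MN(4) d(5)[symmetric] by (auto simp: U_def)
    have "conv (step_fun c B) g x = c \<otimes> g d" if x: "x \<in> U" for x
    proof -
      obtain e where e: "e \<in> P" "rng G e = rng G x" using x by (force simp: U_def)
      have xa: "x \<in> arrows G" "x \<in> N" using x by (auto simp: U_def)
      have e': "e \<in> B" "e \<in> arrows G" "ginv G e \<in> M" using e by (auto simp: P_def)
      have comp: "(ginv G e, x) \<in> composable G"
        using e e' xa by (simp add: composable_iff ginv_in src_ginv)
      then have "g (cmp G (ginv G e) x) = g d"
        using MN(5) e' xa D(3) by blast
      moreover have "conv (step_fun c B) g (cmp G e (cmp G (ginv G e) x)) = c \<otimes> g (cmp G (ginv G e) x)"
        using e e' xa
        by (intro conv_bisection_left[OF g B c]) (simp_all add: cmp_closed ginv_in src_ginv rng_ginv)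
      ultimately show ?thesis using e e' xa by (simp add: cmp_ginv_cancel)
    qed
    then show ?thesis using oU aU d(6) by (intro exI[of _ U]) simp
  qed
qed

lemma conv_closed:
  assumes f: "f \<in> S" and g: "g \<in> S"
  shows "conv f g \<in> S"
proof -
  \<comment> \<open>Induction on the left factor. The set also records membership in
    \<open>S\<close>, which additivity of convolution requires.\<close>
  have "f \<in> {f \<in> S. conv f g \<in> S}"
  proof (rule steinberg_induct[OF f])
    show "(\<lambda>a \<in> arrows G. \<zero>) \<in> {f \<in> S. conv f g \<in> S}"
      using zero_closed conv_zero_left[OF g] by simp
    show "(\<lambda>a \<in> arrows G. h a \<oplus> k a) \<in> {f \<in> S. conv f g \<in> S}"
      if "h \<in> {f \<in> S. conv f g \<in> S}" "k \<in> {f \<in> S. conv f g \<in> S}" for h k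
      using that add_closed conv_add_left g by simp
    show "\<exists>U. openin (gtop G) U \<and> a \<in> U \<and> (\<forall>B. compact_open_bisection G B \<and> B \<subseteq> U \<and>
        (\<forall>b \<in> B. f b = f a) \<longrightarrow> step_fun (f a) B \<in> {f \<in> S. conv f g \<in> S})" if "a \<in> arrows G" for a
      using that f g step_fun_closed conv_step_fun_closed steinberg_mem
      by (intro exI[of _ "arrows G"]) simp
  qed
  then show ?thesis by simp
qed

end

section \<open>Ideals and invariant functions\<close>

text \<open>For infinite \<open>T\<close> the sum is zero by convention and lies in \<open>J\<close>
  as well, so convolution sums can be treated without first bounding their index sets.\<close>

lemma (in abelian_group) finsum_additive_subgroup:
  assumes "additive_subgroup J G" "\<And>x. x \<in> T \<Longrightarrow> f x \<in> J"
  shows "finsum G f T \<in> J"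
  using assms(2)
proof (induction T rule: infinite_finite_induct)
  case (insert x T)
  have "J \<subseteq> carrier G" using assms(1) additive_subgroup.a_subset by blast
  then have "f \<in> T \<rightarrow> carrier G" "f x \<in> carrier G" using insert.prems by auto
  then show ?case
    using insert additive_subgroup.a_closed[OF assms(1)] by (simp add: finsum_insert)
qed (use additive_subgroup.zero_closed[OF assms(1)] in auto)

section \<open>Passing between invariant functions and ideals\<close>

context steinberg
begin

lemma two_sided_idealD:
  assumes "J \<in> two_sided_ideals R"
  shows "additive_subgroup J R" "J \<subseteq> carrier R" "\<zero> \<in> J" "\<And>x y. \<lbrakk>x \<in> J; y \<in> J\<rbrakk> \<Longrightarrow> x \<oplus> y \<in> J"
    "\<And>x. x \<in> J \<Longrightarrow> \<ominus> x \<in> J"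
    "\<And>x y. \<lbrakk>x \<in> J; y \<in> carrier R\<rbrakk> \<Longrightarrow> x \<otimes> y \<in> J \<and> y \<otimes> x \<in> J"
proof -
  show J: "additive_subgroup J R" using assms by (simp add: two_sided_ideals_def)
  show "J \<subseteq> carrier R" "\<zero> \<in> J" "\<And>x y. \<lbrakk>x \<in> J; y \<in> J\<rbrakk> \<Longrightarrow> x \<oplus> y \<in> J"
    using additive_subgroup.a_subset[OF J] additive_subgroup.zero_closed[OF J]
      additive_subgroup.a_closed[OF J] by auto
  show "\<And>x. x \<in> J \<Longrightarrow> \<ominus> x \<in> J"
    using subgroup.m_inv_closed[OF additive_subgroup.a_subgroup[OF J]] by (simp add: a_inv_def)
  show "\<And>x y. \<lbrakk>x \<in> J; y \<in> carrier R\<rbrakk> \<Longrightarrow> x \<otimes> y \<in> J \<and> y \<otimes> x \<in> J"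
    using assms by (simp add: two_sided_ideals_def)
qed

lemma steinberg_idealD:
  assumes "I \<in> two_sided_ideals A"
  shows "I \<subseteq> S" "(\<lambda>a \<in> arrows G. \<zero>) \<in> I" "\<And>f g. \<lbrakk>f \<in> I; g \<in> I\<rbrakk> \<Longrightarrow> (\<lambda>a \<in> arrows G. f a \<oplus> g a) \<in> I"
    "\<And>f g. \<lbrakk>f \<in> I; g \<in> S\<rbrakk> \<Longrightarrow> conv g f \<in> I" "\<And>f g. \<lbrakk>f \<in> I; g \<in> S\<rbrakk> \<Longrightarrow> conv f g \<in> I"
proof -
  have I: "additive_subgroup I A" using assms by (simp add: two_sided_ideals_def)
  show "I \<subseteq> S" "(\<lambda>a \<in> arrows G. \<zero>) \<in> I" "\<And>f g. \<lbrakk>f \<in> I; g \<in> I\<rbrakk> \<Longrightarrow> (\<lambda>a \<in> arrows G. f a \<oplus> g a) \<in> I"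
    using additive_subgroup.a_subset[OF I] additive_subgroup.zero_closed[OF I]
      additive_subgroup.a_closed[OF I] by auto
  show "\<And>f g. \<lbrakk>f \<in> I; g \<in> S\<rbrakk> \<Longrightarrow> conv g f \<in> I" "\<And>f g. \<lbrakk>f \<in> I; g \<in> S\<rbrakk> \<Longrightarrow> conv f g \<in> I"
    using assms by (simp_all add: two_sided_ideals_def)
qed

text \<open>A basic set Z(F) is a finite intersection of sets Z({r}), so continuity can be tested
  one ring element at a time: each \<open>r\<close> must belong to the ideal on an open set of
  units.\<close>

lemma invariant_functions_iff:
  "\<rho> \<in> invariant_functions R G \<longleftrightarrow> \<rho> \<in> unit_space G \<rightarrow>\<^sub>E two_sided_ideals R \<and>
     (\<forall>r \<in> carrier R. openin (gtop G) {u \<in> unit_space G. r \<in> \<rho> u}) \<and>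
     (\<forall>a \<in> arrows G. \<rho> (src G a) = \<rho> (rng G a))"
proof -
  let ?\<S> = "{{I \<in> two_sided_ideals R. F \<subseteq> I} | F. F \<subseteq> carrier R \<and> finite F}"
  have top: "topspace (unit_top G) = unit_space G" using units_subset by auto
  have "continuous_map (unit_top G) (ideal_topology R) \<rho> \<longleftrightarrow>
      (\<forall>r \<in> carrier R. openin (gtop G) {u \<in> unit_space G. r \<in> \<rho> u})"
    if \<rho>: "\<rho> \<in> unit_space G \<rightarrow>\<^sub>E two_sided_ideals R"
  proof
    assume L: "continuous_map (unit_top G) (ideal_topology R) \<rho>"
    show "\<forall>r \<in> carrier R. openin (gtop G) {u \<in> unit_space G. r \<in> \<rho> u}"
    proof
      fix r assume r: "r \<in> carrier R"
      then have "{I \<in> two_sided_ideals R. {r} \<subseteq> I} \<in> ?\<S>" by blast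
      then have "openin (unit_top G)
          (\<rho> -` {I \<in> two_sided_ideals R. {r} \<subseteq> I} \<inter> topspace (unit_top G))"
        using L unfolding ideal_topology_def continuous_on_generated_topo_iff by blast
      moreover have "\<rho> -` {I \<in> two_sided_ideals R. {r} \<subseteq> I} \<inter> topspace (unit_top G)
          = {u \<in> unit_space G. r \<in> \<rho> u}"
        using \<rho> top by auto
      ultimately show "openin (gtop G) {u \<in> unit_space G. r \<in> \<rho> u}"
        by (simp add: openin_unit_top_iff)
    qed
  next
    assume R: "\<forall>r \<in> carrier R. openin (gtop G) {u \<in> unit_space G. r \<in> \<rho> u}"
    show "continuous_map (unit_top G) (ideal_topology R) \<rho>"
      unfolding ideal_topology_def
    proof (rule continuous_on_generated_topo)
      fix U assume "U \<in> ?\<S>"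
      then obtain F where F: "F \<subseteq> carrier R" "finite F" "U = {I \<in> two_sided_ideals R. F \<subseteq> I}"
        by blast
      \<comment> \<open>Inserting \<open>unit_space G\<close> keeps the family nonempty when
        \<open>F\<close> is empty.\<close>
      have "openin (gtop G) (\<Inter>(insert (unit_space G) ((\<lambda>r. {u \<in> unit_space G. r \<in> \<rho> u}) ` F)))"
        using F R open_units by (intro openin_Inter) auto
      moreover have "\<rho> -` U \<inter> topspace (unit_top G)
          = \<Inter>(insert (unit_space G) ((\<lambda>r. {u \<in> unit_space G. r \<in> \<rho> u}) ` F))"
        using \<rho> top F(3) by auto
      ultimately show "openin (unit_top G) (\<rho> -` U \<inter> topspace (unit_top G))"
        by (simp add: openin_unit_top_iff)
    next
      have "two_sided_ideals R \<in> ?\<S>" by (rule CollectI, rule exI[of _ "{}"]) simp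
      then show "\<rho> ` topspace (unit_top G) \<subseteq> \<Union>?\<S>"
        using \<rho> top by blast
    qed
  qed
  then show ?thesis unfolding invariant_functions_def by blast
qed

lemma invariant_functionsD:
  assumes "\<rho> \<in> invariant_functions R G"
  shows "u \<in> unit_space G \<Longrightarrow> \<rho> u \<in> two_sided_ideals R"
    and "a \<in> arrows G \<Longrightarrow> \<rho> (rng G a) = \<rho> (src G a)"
    and "r \<in> carrier R \<Longrightarrow> openin (gtop G) {u \<in> unit_space G. r \<in> \<rho> u}"
  using assms unfolding invariant_functions_iff by auto

definition ideal_of :: "('g \<Rightarrow> 'r set) \<Rightarrow> ('g \<Rightarrow> 'r) set" where
  "ideal_of \<rho> = {f \<in> S. \<forall>a \<in> arrows G. f a \<in> \<rho> (src G a)}"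

definition fun_of :: "('g \<Rightarrow> 'r) set \<Rightarrow> 'g \<Rightarrow> 'r set" where
  "fun_of I = (\<lambda>u \<in> unit_space G. (\<lambda>f. f u) ` I)"

lemma ideal_of_additive:
  assumes "\<rho> \<in> invariant_functions R G"
  shows "additive_subgroup (ideal_of \<rho>) A"
proof (intro additive_subgroup.intro subgroup.intro)
  note \<rho> = two_sided_idealD[OF invariant_functionsD(1)[OF assms src_in]]
  show "ideal_of \<rho> \<subseteq> carrier (add_monoid A)" by (auto simp: ideal_of_def)
  show "\<one>\<^bsub>add_monoid A\<^esub> \<in> ideal_of \<rho>" using \<rho>(3) by (simp add: ideal_of_def zero_closed)
  fix f assume f: "f \<in> ideal_of \<rho>"
  then have "f \<in> S" by (simp add: ideal_of_def)
  then have "inv\<^bsub>add_monoid A\<^esub> f = (\<lambda>a \<in> arrows G. \<ominus> f a)"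
    using steinberg_a_inv unfolding a_inv_def by blast
  then show "inv\<^bsub>add_monoid A\<^esub> f \<in> ideal_of \<rho>"
    using f \<rho>(5) by (simp add: ideal_of_def neg_closed)
  fix g assume "g \<in> ideal_of \<rho>"
  then show "f \<otimes>\<^bsub>add_monoid A\<^esub> g \<in> ideal_of \<rho>"
    using f \<rho>(4) by (simp add: ideal_of_def add_closed)
qed

text \<open>In \<open>conv g f\<close> the argument of \<open>f\<close> has the source of
  \<open>c\<close>, so its values already lie in the right ideal. In \<open>conv f g\<close> the
  argument of \<open>f\<close> shares only its range with \<open>c\<close>, and invariance of
  \<open>\<rho>\<close> bridges the gap.\<close>

lemma ideal_of_ideal:
  assumes "\<rho> \<in> invariant_functions R G"
  shows "ideal_of \<rho> \<in> two_sided_ideals A"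
proof -
  note \<rho> = two_sided_idealD[OF invariant_functionsD(1)[OF assms src_in]]
  have "conv g f \<in> ideal_of \<rho>" "conv f g \<in> ideal_of \<rho>" if f: "f \<in> ideal_of \<rho>" and g: "g \<in> S" for f g
  proof -
    have fS: "f \<in> S" and f\<rho>: "\<And>a. a \<in> arrows G \<Longrightarrow> f a \<in> \<rho> (src G a)"
      using f by (auto simp: ideal_of_def)
    have "conv g f c \<in> \<rho> (src G c)" "conv f g c \<in> \<rho> (src G c)" if c: "c \<in> arrows G" for c
    proof -
      have x: "cmp G (ginv G b) c \<in> arrows G" "src G (cmp G (ginv G b) c) = src G c"
        if "b \<in> arrows G" "rng G b = rng G c" for b
        using that c by (simp_all add: cmp_closed ginv_in src_ginv)
      show "conv g f c \<in> \<rho> (src G c)"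
        unfolding convolution_def restrict_apply'[OF c]
      proof (rule finsum_additive_subgroup[OF \<rho>(1)[OF c]], elim CollectE conjE)
        fix b assume b: "b \<in> arrows G" "rng G b = rng G c"
        have "f (cmp G (ginv G b) c) \<in> \<rho> (src G c)" using f\<rho>[OF x(1)[OF b]] x(2)[OF b] by simp
        then show "g b \<otimes> f (cmp G (ginv G b) c) \<in> \<rho> (src G c)"
          using \<rho>(6)[OF c] steinberg_mem[OF g b(1)] by blast
      qed
      show "conv f g c \<in> \<rho> (src G c)"
        unfolding convolution_def restrict_apply'[OF c]
      proof (rule finsum_additive_subgroup[OF \<rho>(1)[OF c]], elim CollectE conjE)
        fix b assume b: "b \<in> arrows G" "rng G b = rng G c"
        have "\<rho> (src G b) = \<rho> (src G c)"
          using b c invariant_functionsD(2)[OF assms, of b] invariant_functionsD(2)[OF assms, of c]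
          by simp
        then have "f b \<in> \<rho> (src G c)" using f\<rho>[OF b(1)] by simp
        then show "f b \<otimes> g (cmp G (ginv G b) c) \<in> \<rho> (src G c)"
          using \<rho>(6)[OF c] steinberg_mem[OF g x(1)[OF b]] by blast
      qed
    qed
    then show "conv g f \<in> ideal_of \<rho>" "conv f g \<in> ideal_of \<rho>"
      using fS g by (simp_all add: ideal_of_def conv_closed)
  qed
  then show ?thesis
    unfolding two_sided_ideals_def using ideal_of_additive[OF assms] by simp
qed

lemma ideal_of_eq_span:
  assumes "\<rho> \<in> invariant_functions R G"
  shows "ideal_of \<rho> = module_span R A {c \<odot>\<^bsub>A\<^esub> char_fun R G B | c B.
    compact_open_bisection G B \<and> c \<in> carrier R \<inter> (\<Inter>u \<in> invariant_hull G (src G ` B). \<rho> u)}"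
    (is "_ = module_span R A ?X")
proof -
  note \<rho> = two_sided_idealD[OF invariant_functionsD(1)[OF assms src_in]]
  have sub: "submodule (ideal_of \<rho>) R A"
  proof (intro submodule.intro submodule_axioms.intro)
    show "subgroup (ideal_of \<rho>) (add_monoid A)"
      using additive_subgroup.a_subgroup[OF ideal_of_additive[OF assms]] .
    show "c \<odot>\<^bsub>A\<^esub> f \<in> ideal_of \<rho>" if "c \<in> carrier R" "f \<in> ideal_of \<rho>" for c f
      using that \<rho>(6) by (simp add: ideal_of_def smult_closed)
  qed
  have X: "?X \<subseteq> ideal_of \<rho>"
  proof clarify
    fix c B assume B: "compact_open_bisection G B"
      and c: "c \<in> carrier R" "c \<in> (\<Inter>u \<in> invariant_hull G (src G ` B). \<rho> u)"
    have "step_fun c B a \<in> \<rho> (src G a)" if a: "a \<in> arrows G" for a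
    proof (cases "a \<in> B")
      case True
      \<comment> \<open>The unit \<open>src G a\<close> is itself an arrow from
        \<open>src G a\<close>, which puts it into the hull.\<close>
      then have "src G a \<in> invariant_hull G (src G ` B)"
        unfolding invariant_hull_def using a src_in[OF a] rng_unit src_unit unit_in_arrows
        by (intro image_eqI[of _ _ "src G a"]) auto
      then show ?thesis using c(2) True a by (auto simp: step_fun_apply)
    next
      case False
      then show ?thesis using a \<rho>(3) by (simp add: step_fun_apply)
    qed
    then show "c \<odot>\<^bsub>A\<^esub> char_fun R G B \<in> ideal_of \<rho>"
      using B c(1) by (simp add: smult_char_fun ideal_of_def step_fun_closed del: steinberg_simps)
  qed
  have "f \<in> N" if f: "f \<in> ideal_of \<rho>" and N: "submodule N R A" "?X \<subseteq> N" for f N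
  proof -
    have fS: "f \<in> S" and f\<rho>: "\<And>a. a \<in> arrows G \<Longrightarrow> f a \<in> \<rho> (src G a)"
      using f by (auto simp: ideal_of_def)
    have N': "subgroup N (add_monoid A)" using N(1) by (simp add: submodule_def)
    show ?thesis
    proof (rule steinberg_induct[OF fS])
      show "(\<lambda>a \<in> arrows G. \<zero>) \<in> N" using subgroup.one_closed[OF N'] by simp
      show "(\<lambda>a \<in> arrows G. g a \<oplus> h a) \<in> N" if "g \<in> N" "h \<in> N" for g h
        using subgroup.m_closed[OF N' that] by simp
      fix a assume a: "a \<in> arrows G"
      have "step_fun (f a) B \<in> N"
        if B: "compact_open_bisection G B" and eq: "\<forall>b \<in> B. f b = f a" for B
      proof -
        \<comment> \<open>A point of the hull is joined by an arrow to the source of some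
          \<open>b\<close> in \<open>B\<close>. There the ideal contains \<open>f b = f a\<close>,
          and \<open>\<rho>\<close> is constant along arrows.\<close>
        have "f a \<in> \<rho> u" if u: "u \<in> invariant_hull G (src G ` B)" for u
        proof -
          obtain x b where x: "u = rng G x" "x \<in> arrows G" "src G x = src G b" "b \<in> B"
            using u unfolding invariant_hull_def by blast
          then have "f b \<in> \<rho> (src G b)" using f\<rho> bisectionD(5)[OF B] by blast
          then show ?thesis
            using x eq invariant_functionsD(2)[OF assms x(2)] by auto
        qed
        then have "f a \<odot>\<^bsub>A\<^esub> char_fun R G B \<in> ?X"
          using B steinberg_mem[OF fS a] by blast
        then show ?thesis
          using N(2) smult_char_fun[OF steinberg_mem[OF fS a], of B] by auto
      qed
      then show "\<exists>U. openin (gtop G) U \<and> a \<in> U \<and> (\<forall>B. compact_open_bisection G B \<and> B \<subseteq> U \<and>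
          (\<forall>b \<in> B. f b = f a) \<longrightarrow> step_fun (f a) B \<in> N)"
        using a by (intro exI[of _ "arrows G"]) auto
    qed
  qed
  then show ?thesis
    unfolding module_span_def using sub X by blast
qed

section \<open>Values of an ideal and its recovery from them\<close>

lemma ideal_value_transport:
  assumes I: "I \<in> two_sided_ideals A" and f: "f \<in> I" and a: "a \<in> arrows G"
  shows "\<exists>g \<in> I. g (src G a) = f a" "\<exists>g \<in> I. g (rng G a) = f a"
    "\<exists>g \<in> I. g a = f (src G a)" "\<exists>g \<in> I. g a = f (rng G a)"
proof -
  note I' = steinberg_idealD[OF I]
  have fS: "f \<in> S" using f I'(1) by blast
  \<comment> \<open>Multiplying by the characteristic function of \<open>B\<close> or of its
    inverse, on the left or on the right, moves values of \<open>f\<close> between \<open>a\<close>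
    and its two ends.\<close>
  obtain B where B: "compact_open_bisection G B" "a \<in> B"
    using ample_basis[OF openin_topspace a] by blast
  note C = ginv_bisection[OF B(1)]
  have aC: "ginv G a \<in> ginv G ` B" using B(2) by blast
  note u = unit_in_arrows[OF src_in[OF a]] unit_in_arrows[OF rng_in[OF a]]
  have *: "step_fun \<one> B \<in> S" "step_fun \<one> (ginv G ` B) \<in> S"
    using B(1) C step_fun_closed by auto
  have "conv (step_fun \<one> (ginv G ` B)) f (src G a) = f a"
    using conv_bisection_left[OF fS C one_closed aC a src_ginv[OF a]] fS a
    by (simp add: cmp_ginv_left steinberg_mem)
  then show "\<exists>g \<in> I. g (src G a) = f a" using I'(4)[OF f *(2)] by blast
  have "conv f (step_fun \<one> (ginv G ` B)) (rng G a) = f a"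
    using conv_bisection_right[OF fS C one_closed aC a] fS a
    by (simp add: cmp_ginv_right rng_ginv steinberg_mem)
  then show "\<exists>g \<in> I. g (rng G a) = f a" using I'(5)[OF f *(2)] by blast
  have "conv (step_fun \<one> B) f a = f (src G a)"
    using conv_bisection_left[OF fS B(1) one_closed B(2) u(1)] fS a u
    by (simp add: cmp_src rng_unit src_in steinberg_mem)
  then show "\<exists>g \<in> I. g a = f (src G a)" using I'(4)[OF f *(1)] by blast
  have "conv f (step_fun \<one> B) a = f (rng G a)"
    using conv_bisection_right[OF fS B(1) one_closed B(2) u(2)] fS a u
    by (simp add: cmp_rng src_unit rng_in steinberg_mem)
  then show "\<exists>g \<in> I. g a = f (rng G a)" using I'(5)[OF f *(1)] by blast
qed

lemma fun_of_invariant: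
  assumes I: "I \<in> two_sided_ideals A"
  shows "fun_of I \<in> invariant_functions R G"
  unfolding invariant_functions_iff
proof (intro conjI ballI)
  note I' = steinberg_idealD[OF I]
  have mem: "f u \<in> carrier R" if "f \<in> I" "u \<in> unit_space G" for f u
    using that I'(1) steinberg_mem unit_in_arrows by blast
  \<comment> \<open>\<open>I\<close> is closed under convolution, so multiplication by the scalar
    \<open>c\<close> at \<open>u\<close> is realized by c 1_K with K a neighbourhood of
    \<open>u\<close> in the units.\<close>
  have smul: "\<exists>g \<in> I. g u = c \<otimes> f u" if f: "f \<in> I" and u: "u \<in> unit_space G" and c: "c \<in> carrier R" for f u c
  proof -
    obtain K where K: "compact_open_bisection G K" "u \<in> K" "K \<subseteq> unit_space G"
      by (rule unit_nbhd[OF open_units u u])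
    have "conv (step_fun c K) f u = c \<otimes> f u"
      using conv_units_left[OF _ K(1,3) c, of f u] f I'(1) u K(2) unit_in_arrows rng_unit by auto
    then show ?thesis using I'(4)[OF f step_fun_closed[OF c K(1)]] by blast
  qed
  have "(\<lambda>f. f u) ` I \<in> two_sided_ideals R" if u: "u \<in> unit_space G" for u
    unfolding two_sided_ideals_def
  proof (intro CollectI conjI ballI additive_subgroup.intro subgroup.intro)
    note ua = unit_in_arrows[OF u]
    show "(\<lambda>f. f u) ` I \<subseteq> carrier (add_monoid R)" using mem u by auto
    show "\<one>\<^bsub>add_monoid R\<^esub> \<in> (\<lambda>f. f u) ` I" using I'(2) ua by (intro image_eqI[OF _ I'(2)]) simp
    fix x assume "x \<in> (\<lambda>f. f u) ` I"
    then obtain f where f: "f \<in> I" "x = f u" by blast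
    have x: "x \<in> carrier R" using f mem u by simp
    have *: "c \<otimes> x \<in> (\<lambda>f. f u) ` I" if "c \<in> carrier R" for c
      using smul[OF f(1) u that] f(2) by (simp add: image_iff) metis
    \<comment> \<open>Negatives come from the scalar multiple by
      \<open>\<ominus> \<one>\<close>.\<close>
    have "\<ominus> x \<in> (\<lambda>f. f u) ` I" using *[of "\<ominus> \<one>"] x by (simp add: l_minus)
    then show "inv\<^bsub>add_monoid R\<^esub> x \<in> (\<lambda>f. f u) ` I" by (simp add: a_inv_def)
    show "c \<otimes> x \<in> (\<lambda>f. f u) ` I" "x \<otimes> c \<in> (\<lambda>f. f u) ` I" if "c \<in> carrier R" for c
      using *[OF that] x that by (simp_all add: m_comm)
    fix y assume "y \<in> (\<lambda>f. f u) ` I"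
    then obtain g where g: "g \<in> I" "y = g u" by blast
    show "x \<otimes>\<^bsub>add_monoid R\<^esub> y \<in> (\<lambda>f. f u) ` I"
      using f g ua by (intro image_eqI[OF _ I'(3)[OF f(1) g(1)]]) simp
  qed
  then show "fun_of I \<in> unit_space G \<rightarrow>\<^sub>E two_sided_ideals R" by (simp add: fun_of_def)
  show "openin (gtop G) {u \<in> unit_space G. r \<in> fun_of I u}" for r
  proof -
    have eq: "{u \<in> unit_space G. r \<in> fun_of I u} = (\<Union>f \<in> I. unit_space G \<inter> {u \<in> arrows G. f u = r})"
      using unit_in_arrows by (auto simp: fun_of_def)
    have "openin (gtop G) (unit_space G \<inter> {u \<in> arrows G. f u = r})" if "f \<in> I" for f
      using that I'(1) level_open[of f "\<lambda>x. x = r"] open_units by blast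
    then show ?thesis unfolding eq by (intro openin_Union) blast
  qed
  fix a assume a: "a \<in> arrows G"
  \<comment> \<open>Both ends are compared with the values at the arrow itself.\<close>
  have "(\<lambda>f. f (src G a)) ` I = (\<lambda>f. f a) ` I" "(\<lambda>f. f (rng G a)) ` I = (\<lambda>f. f a) ` I"
    by (intro equalityI image_subsetI; unfold image_iff; metis ideal_value_transport[OF I _ a])+
  then show "fun_of I (src G a) = fun_of I (rng G a)"
    using a by (simp add: fun_of_def src_in rng_in)
qed

text \<open>Conjugation by a bisection B through \<open>a\<close> with range inside L: r 1_L times
  1_B is r 1_B, and the characteristic function of the inverse of B times r 1_B is \<open>r\<close>
  times that of the source set of B. This will show that the units where the crucial fact fails form
  an invariant set.\<close>

lemma step_fun_transport:
  assumes I: "I \<in> two_sided_ideals A" and r: "r \<in> carrier R"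
    and L: "compact_open_bisection G L" "L \<subseteq> unit_space G" "step_fun r L \<in> I"
    and a: "a \<in> arrows G" "rng G a \<in> L"
  shows "\<exists>K. compact_open_bisection G K \<and> K \<subseteq> unit_space G \<and> src G a \<in> K \<and> step_fun r K \<in> I"
proof -
  note I' = steinberg_idealD[OF I]
  obtain B where B: "compact_open_bisection G B" "a \<in> B" "B \<subseteq> {a \<in> arrows G. rng G a \<in> L}"
    using ample_basis[OF openin_rng_vimage[OF bisectionD(1)[OF L(1)]]] a by blast
  note B' = bisectionD[OF B(1)] and C = ginv_bisection[OF B(1)]
  have K: "compact_open_bisection G (src G ` B)" "src G ` B \<subseteq> unit_space G"
    using B' open_map_src continuous_src image_compactin src_in
    by (auto intro!: compact_open_units_bisection)
  have one: "step_fun \<one> B \<in> S" "step_fun \<one> (ginv G ` B) \<in> S"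
    using B(1) C step_fun_closed by auto
  have rB: "step_fun r B \<in> S" "step_fun r (src G ` B) \<in> S"
    using r B(1) K step_fun_closed by auto
  have "conv (step_fun r L) (step_fun \<one> B) = step_fun r B"
  proof (rule steinberg_ext[OF conv_closed rB(1)])
    fix x assume "x \<in> arrows G"
    then show "conv (step_fun r L) (step_fun \<one> B) x = step_fun r B x"
      using conv_units_left[OF one(1) L(1,2) r] B(3) r by (auto simp: step_fun_apply)
  qed (use one L r step_fun_closed in auto)
  then have rBI: "step_fun r B \<in> I" using I'(5)[OF L(3) one(1)] by simp
  have "conv (step_fun \<one> (ginv G ` B)) (step_fun r B) = step_fun r (src G ` B)"
  proof (rule steinberg_ext[OF conv_closed[OF one(2) rB(1)] rB(2)])
    fix x assume x: "x \<in> arrows G"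
    show "conv (step_fun \<one> (ginv G ` B)) (step_fun r B) x = step_fun r (src G ` B) x"
    proof (cases "rng G x \<in> src G ` B")
      case True
      then obtain b where b: "b \<in> B" "rng G x = src G b" by auto
      have bx: "b \<in> arrows G" "cmp G b x \<in> arrows G" "rng G (cmp G b x) = rng G b"
        using b x B'(5) by (auto simp: cmp_closed)
      have "conv (step_fun \<one> (ginv G ` B)) (step_fun r B) (cmp G (ginv G b) (cmp G b x))
          = \<one> \<otimes> step_fun r B (cmp G b x)"
        using b bx by (intro conv_bisection_left[OF rB(1) C one_closed]) (auto simp: src_ginv)
      then have val: "conv (step_fun \<one> (ginv G ` B)) (step_fun r B) x = step_fun r B (cmp G b x)"
        using b bx x r by (simp add: ginv_cmp_cancel steinberg_mem[OF rB(1)])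
      \<comment> \<open>\<open>cmp G b x\<close> has the range of \<open>b\<close>, so it can lie in
        \<open>B\<close> only if it equals \<open>b\<close>, that is, if \<open>x\<close> is the
        unit \<open>src G b\<close>.\<close>
      have "cmp G b x \<in> B \<longleftrightarrow> x \<in> src G ` B"
      proof
        assume "cmp G b x \<in> B"
        then have "cmp G b x = b" using B'(3) b(1) bx(3) by (auto simp: inj_on_def)
        then have "x = src G b"
          using ginv_cmp_cancel[of b x] cmp_ginv_left[of b] b bx x by simp
        then show "x \<in> src G ` B" using b(1) by blast
      next
        assume "x \<in> src G ` B"
        then have "x = src G b" using K(2) b(2) rng_unit by auto
        then show "cmp G b x \<in> B" using b bx by (simp add: cmp_src)
      qed
      then show ?thesis using val x bx by (simp add: step_fun_apply)
    next
      case False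
      have "rng G ` ginv G ` B = src G ` B"
        using B'(5) rng_ginv by (force simp: image_iff)
      moreover have "x \<notin> src G ` B" using False K(2) rng_unit by force
      ultimately show ?thesis
        using False x conv_bisection_left_zero[OF rB(1) x] by (simp add: step_fun_apply)
    qed
  qed
  then have "step_fun r (src G ` B) \<in> I" using I'(4)[OF rBI one(2)] by simp
  then show ?thesis using K B(2) by blast
qed

text \<open>The crux: if no multiple \<open>r\<close> of the characteristic function of a neighbourhood of \<open>u\<close> lay in
  \<open>I\<close>, the units with this property would form a closed invariant set.  Effectiveness of the reduction
  to that set yields such a unit \<open>v\<close> close to \<open>u\<close> where \<open>f\<close> vanishes on the nontrivial isotropy; cutting
  \<open>f\<close> down on both sides to a small neighbourhood of \<open>v\<close> then leaves exactly \<open>r\<close> times its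
  characteristic function.\<close>

lemma ideal_contains_step_fun:
  assumes eff: "strongly_effective G" and I: "I \<in> two_sided_ideals A"
    and f: "f \<in> I" and u: "u \<in> unit_space G"
  shows "\<exists>L. compact_open_bisection G L \<and> L \<subseteq> unit_space G \<and> u \<in> L \<and> step_fun (f u) L \<in> I"
proof (rule ccontr)
  note I' = steinberg_idealD[OF I]
  have fS: "f \<in> S" using f I'(1) by blast
  define r where "r = f u"
  have r: "r \<in> carrier R" using fS u unit_in_arrows steinberg_mem by (simp add: r_def)
  define \<L> where "\<L> = {L. compact_open_bisection G L \<and> L \<subseteq> unit_space G \<and> step_fun r L \<in> I}"
  let ?V = "unit_space G - \<Union>\<L>"
  assume "\<not> ?thesis"
  then have uV: "u \<in> ?V" using u by (auto simp: \<L>_def r_def)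
  have "openin (gtop G) (\<Union>\<L>)" "\<Union>\<L> \<subseteq> unit_space G"
    using bisectionD(1) by (auto simp: \<L>_def)
  then have "openin (unit_top G) (\<Union>\<L>)" by (simp add: openin_unit_top_iff)
  moreover have "topspace (unit_top G) = unit_space G" using units_subset by auto
  ultimately have closed: "closedin (unit_top G) ?V" by (metis closedin_diff closedin_topspace)
  have inv: "invariant G ?V"
    unfolding invariant_def
  proof (intro conjI ballI impI)
    fix a assume a: "a \<in> arrows G" "src G a \<in> ?V"
    \<comment> \<open>Transport carries the good property from range to source; invariance of the
      bad set \<open>?V\<close> is the contrapositive.\<close>
    have "rng G a \<notin> \<Union>\<L>"
    proof
      assume "rng G a \<in> \<Union>\<L>"
      then obtain L where "compact_open_bisection G L" "L \<subseteq> unit_space G" "step_fun r L \<in> I" "rng G a \<in> L"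
        by (auto simp: \<L>_def)
      from step_fun_transport[OF I r this(1-3) a(1) this(4)] have "src G a \<in> \<Union>\<L>"
        by (auto simp: \<L>_def)
      then show False using a(2) by blast
    qed
    then show "rng G a \<in> ?V" using rng_in[OF a(1)] by simp
  qed blast
  let ?K = "unit_space G \<inter> {v \<in> arrows G. f v = r}"
  have K: "openin (gtop G) ?K" "?V \<inter> ?K \<noteq> {}"
    using level_open[OF fS, of "\<lambda>x. x = r"] open_units uV unit_in_arrows by (auto simp: r_def)
  \<comment> \<open>The support of \<open>f\<close> off the units: compact because the units are
    open, open because they are closed.\<close>
  let ?D = "supp f - unit_space G"
  have D: "compactin (gtop G) ?D" "openin (gtop G) ?D" "?D \<inter> unit_space G = {}"
  proof -
    have "closedin (gtop G) (arrows G - unit_space G)" using open_units by blast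
    from compact_Int_closedin[OF supp_compact[OF fS] this]
    show "compactin (gtop G) ?D" by (rule back_subst) blast
    show "openin (gtop G) ?D"
      using level_open[OF fS, of "\<lambda>x. x \<noteq> \<zero>"] closed_units openin_diff by blast
  qed blast
  obtain v where v: "v \<in> ?V \<inter> ?K" "\<And>b. b \<in> ?D \<Longrightarrow> \<not> (rng G b = v \<and> src G b = v)"
    using strongly_effective_unit_without_isotropy[OF ample_Hausdorff_groupoid_axioms eff closed inv D K]
    by blast
  obtain U where U: "openin (gtop G) U" "v \<in> U" "\<And>b. b \<in> ?D \<Longrightarrow> \<not> (rng G b \<in> U \<and> src G b \<in> U)"
    using no_isotropy_nbhd[OF D(1) _ v(2)] v(1) by blast
  have "openin (gtop G) (U \<inter> ?K)" "v \<in> U \<inter> ?K" "v \<in> unit_space G"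
    using U v K by blast+
  from unit_nbhd[OF this] obtain L where L: "compact_open_bisection G L" "v \<in> L" "L \<subseteq> U \<inter> ?K"
    "L \<subseteq> unit_space G"
    by blast
  have L1: "step_fun \<one> L \<in> S" using L(1) step_fun_closed by blast
  \<comment> \<open>Of the arrows with both ends in \<open>L\<close>, the units carry the value
    \<open>r\<close> since \<open>L\<close> lies in \<open>?K\<close>. On the others
    \<open>f\<close> vanishes, because \<open>L\<close> lies in \<open>U\<close> and no arrow of
    \<open>?D\<close> has both ends there.\<close>
  have "conv (step_fun \<one> L) (conv f (step_fun \<one> L)) = step_fun r L"
  proof (rule steinberg_ext)
    show "conv (step_fun \<one> L) (conv f (step_fun \<one> L)) \<in> S" "step_fun r L \<in> S"
      using L1 fS L(1) r conv_closed step_fun_closed by auto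
    fix a assume a: "a \<in> arrows G"
    have fa: "f a \<in> carrier R" using a fS steinberg_mem by blast
    have eq: "conv (step_fun \<one> L) (conv f (step_fun \<one> L)) a
        = (if rng G a \<in> L \<and> src G a \<in> L then f a else \<zero>)"
      using conv_units_left[OF conv_closed[OF fS L1] L(1,4) one_closed a]
        conv_units_right[OF fS L(1,4) one_closed a] fa by simp
    show "conv (step_fun \<one> L) (conv f (step_fun \<one> L)) a = step_fun r L a"
    proof (cases "a \<in> L")
      case True
      then have "rng G a = a" "src G a = a" "f a = r"
        using L(3,4) rng_unit src_unit by auto
      then show ?thesis using eq True a by (simp add: step_fun_apply)
    next
      case False
      have "f a = \<zero>" if ra: "rng G a \<in> L" "src G a \<in> L"
      proof (rule ccontr)
        assume "f a \<noteq> \<zero>"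
        moreover have "a \<notin> unit_space G" using ra(1) False rng_unit by auto
        ultimately have "a \<in> ?D" using a by blast
        then show False using U(3) ra L(3) by blast
      qed
      then show ?thesis using eq False a by (auto simp: step_fun_apply)
    qed
  qed
  then have "step_fun r L \<in> I" using I'(4)[OF I'(5)[OF f L1] L1] by simp
  then have "v \<in> \<Union>\<L>" using L by (auto simp: \<L>_def)
  then show False using v(1) by blast
qed

text \<open>For the nontrivial inclusion, the value \<open>f a\<close> is attained at
  \<open>src G a\<close> by a member of \<open>I\<close>, so \<open>I\<close> contains (f a) 1_L for
  some L around that unit. Left multiplication by 1_B, for a bisection B with sources in L, yields
  (f a) 1_B, and \<open>steinberg_induct\<close> assembles \<open>f\<close>.\<close>

lemma ideal_of_fun_of:
  assumes eff: "strongly_effective G" and I: "I \<in> two_sided_ideals A"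
  shows "ideal_of (fun_of I) = I"
proof
  note I' = steinberg_idealD[OF I]
  have "f a \<in> fun_of I (src G a)" if "f \<in> I" "a \<in> arrows G" for f a
    using ideal_value_transport(1)[OF I that] src_in[OF that(2)]
    by (simp add: fun_of_def image_iff) metis
  then show "I \<subseteq> ideal_of (fun_of I)" using I'(1) by (auto simp: ideal_of_def)
  show "ideal_of (fun_of I) \<subseteq> I"
  proof
    fix f assume f: "f \<in> ideal_of (fun_of I)"
    then have fS: "f \<in> S" by (simp add: ideal_of_def)
    show "f \<in> I"
    proof (rule steinberg_induct[OF fS I'(2,3)])
      fix a assume a: "a \<in> arrows G"
      have fa: "f a \<in> carrier R" using fS a steinberg_mem by blast
      have "f a \<in> fun_of I (src G a)"
        using f a unfolding ideal_of_def by blast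
      then obtain g where g: "g \<in> I" "f a = g (src G a)"
        using src_in[OF a] by (auto simp: fun_of_def)
      obtain L where L: "compact_open_bisection G L" "L \<subseteq> unit_space G" "src G a \<in> L" "step_fun (f a) L \<in> I"
        using ideal_contains_step_fun[OF eff I g(1) src_in[OF a]] g(2) by auto
      let ?U = "{b \<in> arrows G. src G b \<in> L}"
      have "step_fun (f a) B \<in> I" if B: "compact_open_bisection G B" "B \<subseteq> ?U" for B
      proof -
        have B1: "step_fun \<one> B \<in> S" "step_fun (f a) B \<in> S" "step_fun (f a) L \<in> S"
          using B(1) L(1) fa step_fun_closed by auto
        have "conv (step_fun \<one> B) (step_fun (f a) L) = step_fun (f a) B"
        proof (rule steinberg_ext[OF conv_closed[OF B1(1,3)] B1(2)])
          fix x assume "x \<in> arrows G"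
          then show "conv (step_fun \<one> B) (step_fun (f a) L) x = step_fun (f a) B x"
            using conv_units_right[OF B1(1) L(1,2) fa] B(2) fa by (auto simp: step_fun_apply)
        qed
        then show ?thesis using I'(4)[OF L(4) B1(1)] by simp
      qed
      then show "\<exists>U. openin (gtop G) U \<and> a \<in> U \<and> (\<forall>B. compact_open_bisection G B \<and> B \<subseteq> U \<and>
          (\<forall>b \<in> B. f b = f a) \<longrightarrow> step_fun (f a) B \<in> I)"
        using a L(1,3) openin_src_vimage bisectionD(1) by (intro exI[of _ ?U]) auto
    qed
  qed
qed

text \<open>Continuity is what makes \<open>ideal_of \<rho>\<close> large enough: if
  \<open>r\<close> lies in \<open>\<rho> u\<close>, it does so on a compact open K around
  \<open>u\<close>, and r 1_K then belongs to the ideal and takes the value \<open>r\<close> at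
  \<open>u\<close>.\<close>

lemma fun_of_ideal_of:
  assumes \<rho>: "\<rho> \<in> invariant_functions R G"
  shows "fun_of (ideal_of \<rho>) = \<rho>"
proof
  fix u
  show "fun_of (ideal_of \<rho>) u = \<rho> u"
  proof (cases "u \<in> unit_space G")
    case False
    have "\<rho> \<in> unit_space G \<rightarrow>\<^sub>E two_sided_ideals R"
      using \<rho> by (simp add: invariant_functions_def)
    from PiE_arb[OF this False] False show ?thesis by (simp add: fun_of_def)
  next
    case u: True
    have "(\<lambda>f. f u) ` ideal_of \<rho> \<subseteq> \<rho> u"
      using u unit_in_arrows src_unit by (fastforce simp: ideal_of_def)
    moreover have "r \<in> (\<lambda>f. f u) ` ideal_of \<rho>" if ru: "r \<in> \<rho> u" for r
    proof -
      have r: "r \<in> carrier R"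
        using ru two_sided_idealD(2)[OF invariant_functionsD(1)[OF \<rho> u]] by blast
      have "u \<in> {u \<in> unit_space G. r \<in> \<rho> u}" using ru u by simp
      from unit_nbhd[OF invariant_functionsD(3)[OF \<rho> r] this u]
      obtain K where K: "compact_open_bisection G K" "u \<in> K" "K \<subseteq> {u \<in> unit_space G. r \<in> \<rho> u}"
        by metis
      have "step_fun r K a \<in> \<rho> (src G a)" if a: "a \<in> arrows G" for a
      proof (cases "a \<in> K")
        case True
        then have "src G a = a" "r \<in> \<rho> a" using K(3) src_unit by auto
        then show ?thesis using True a by (simp add: step_fun_apply)
      next
        case False
        then show ?thesis
          using a two_sided_idealD(3)[OF invariant_functionsD(1)[OF \<rho> src_in[OF a]]]
          by (simp add: step_fun_apply)
      qed
      then have "step_fun r K \<in> ideal_of \<rho>"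
        using step_fun_closed[OF r K(1)] by (simp add: ideal_of_def)
      then show ?thesis
        using K(2) u unit_in_arrows by (intro image_eqI[of _ _ "step_fun r K"]) (simp_all add: step_fun_apply)
    qed
    ultimately show ?thesis using u by (auto simp: fun_of_def)
  qed
qed

lemma ideal_of_bij:
  assumes "strongly_effective G"
  shows "bij_betw ideal_of (invariant_functions R G) (two_sided_ideals A)"
  using assms ideal_of_ideal fun_of_invariant fun_of_ideal_of ideal_of_fun_of
  by (intro bij_betw_byWitness[of _ fun_of]) auto

lemma ideal_of_mono_iff:
  assumes "\<rho>\<^sub>1 \<in> invariant_functions R G" "\<rho>\<^sub>2 \<in> invariant_functions R G"
  shows "ideal_of \<rho>\<^sub>1 \<subseteq> ideal_of \<rho>\<^sub>2 \<longleftrightarrow> (\<forall>u \<in> unit_space G. \<rho>\<^sub>1 u \<subseteq> \<rho>\<^sub>2 u)"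
proof
  assume "ideal_of \<rho>\<^sub>1 \<subseteq> ideal_of \<rho>\<^sub>2"
  then have "fun_of (ideal_of \<rho>\<^sub>1) u \<subseteq> fun_of (ideal_of \<rho>\<^sub>2) u" if "u \<in> unit_space G" for u
    using that by (auto simp: fun_of_def)
  then show "\<forall>u \<in> unit_space G. \<rho>\<^sub>1 u \<subseteq> \<rho>\<^sub>2 u" using assms fun_of_ideal_of by simp
next
  assume "\<forall>u \<in> unit_space G. \<rho>\<^sub>1 u \<subseteq> \<rho>\<^sub>2 u"
  then show "ideal_of \<rho>\<^sub>1 \<subseteq> ideal_of \<rho>\<^sub>2" using src_in by (auto simp: ideal_of_def)
qed

section \<open>Lattice structure and its transfer\<close>

lemma set_add_mem_open:
  assumes "\<rho>\<^sub>1 \<in> invariant_functions R G" "\<rho>\<^sub>2 \<in> invariant_functions R G"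
  shows "openin (gtop G) {u \<in> unit_space G. r \<in> \<rho>\<^sub>1 u <+>\<^bsub>R\<^esub> \<rho>\<^sub>2 u}"
proof -
  let ?T = "{(x, y). x \<in> carrier R \<and> y \<in> carrier R \<and> r = x \<oplus> y}"
  let ?O = "\<lambda>(x, y). {u \<in> unit_space G. x \<in> \<rho>\<^sub>1 u} \<inter> {u \<in> unit_space G. y \<in> \<rho>\<^sub>2 u}"
  have sub: "\<rho>\<^sub>1 u \<subseteq> carrier R" "\<rho>\<^sub>2 u \<subseteq> carrier R" if "u \<in> unit_space G" for u
    using two_sided_idealD(2) invariant_functionsD(1) assms that by blast+
  \<comment> \<open>Each decomposition \<open>r = x \<oplus> y\<close> contributes the open set
    where \<open>x\<close> and \<open>y\<close> lie in the two ideals; this is the continuity of the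
    pointwise sum.\<close>
  have eq: "{u \<in> unit_space G. r \<in> \<rho>\<^sub>1 u <+>\<^bsub>R\<^esub> \<rho>\<^sub>2 u} = \<Union>(?O ` ?T)"
  proof (intro equalityI subsetI)
    fix u assume "u \<in> {u \<in> unit_space G. r \<in> \<rho>\<^sub>1 u <+>\<^bsub>R\<^esub> \<rho>\<^sub>2 u}"
    then obtain x y where "u \<in> unit_space G" "x \<in> \<rho>\<^sub>1 u" "y \<in> \<rho>\<^sub>2 u" "r = x \<oplus> y"
      unfolding set_add_def' by blast
    then show "u \<in> \<Union>(?O ` ?T)" using sub[of u] by (intro UN_I[of "(x, y)"]) auto
  qed (auto simp: set_add_def')
  have "openin (gtop G) (?O p)" if "p \<in> ?T" for p
    using that invariant_functionsD(3)[OF assms(1)] invariant_functionsD(3)[OF assms(2)]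
    by (auto intro: openin_Int)
  then show ?thesis unfolding eq by (intro openin_Union) blast
qed

abbreviation F :: "('g \<Rightarrow> 'r set) gorder" where
  "F \<equiv> invariant_function_lattice R G"

lemma F_simps [simp]:
  "carrier F = invariant_functions R G" "(.=\<^bsub>F\<^esub>) = (=)"
  "\<rho>\<^sub>1 \<sqsubseteq>\<^bsub>F\<^esub> \<rho>\<^sub>2 \<longleftrightarrow> (\<forall>u \<in> unit_space G. \<rho>\<^sub>1 u \<subseteq> \<rho>\<^sub>2 u)"
  by (simp_all add: invariant_function_lattice_def)

lemma least_F:
  assumes \<rho>: "\<rho>\<^sub>1 \<in> invariant_functions R G" "\<rho>\<^sub>2 \<in> invariant_functions R G"
  shows "least F (\<lambda>u \<in> unit_space G. \<rho>\<^sub>1 u <+>\<^bsub>R\<^esub> \<rho>\<^sub>2 u) (Upper F {\<rho>\<^sub>1, \<rho>\<^sub>2})"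
proof -
  note I = invariant_functionsD(1)[OF \<rho>(1)] invariant_functionsD(1)[OF \<rho>(2)]
  \<comment> \<open>The bound is checked unit by unit in the ideal lattice of
    \<open>R\<close>.\<close>
  have least: "least (ideal_lattice R) (\<rho>\<^sub>1 u <+>\<^bsub>R\<^esub> \<rho>\<^sub>2 u) (Upper (ideal_lattice R) {\<rho>\<^sub>1 u, \<rho>\<^sub>2 u})"
    if "u \<in> unit_space G" for u
    using that by (intro least_ideal_add I m_closed l_distr r_distr)
  have sub: "\<rho>\<^sub>1 u \<subseteq> \<rho>\<^sub>1 u <+>\<^bsub>R\<^esub> \<rho>\<^sub>2 u" "\<rho>\<^sub>2 u \<subseteq> \<rho>\<^sub>1 u <+>\<^bsub>R\<^esub> \<rho>\<^sub>2 u"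
      "\<And>J. \<lbrakk>J \<in> two_sided_ideals R; \<rho>\<^sub>1 u \<subseteq> J; \<rho>\<^sub>2 u \<subseteq> J\<rbrakk> \<Longrightarrow> \<rho>\<^sub>1 u <+>\<^bsub>R\<^esub> \<rho>\<^sub>2 u \<subseteq> J"
      "\<rho>\<^sub>1 u <+>\<^bsub>R\<^esub> \<rho>\<^sub>2 u \<in> two_sided_ideals R"
    if "u \<in> unit_space G" for u
    using least[OF that] I[OF that] by (auto simp: least_def Upper_def ideal_lattice_def)
  have "(\<lambda>u \<in> unit_space G. \<rho>\<^sub>1 u <+>\<^bsub>R\<^esub> \<rho>\<^sub>2 u) \<in> invariant_functions R G"
    unfolding invariant_functions_iff
  proof (intro conjI ballI)
    show "(\<lambda>u \<in> unit_space G. \<rho>\<^sub>1 u <+>\<^bsub>R\<^esub> \<rho>\<^sub>2 u) \<in> unit_space G \<rightarrow>\<^sub>E two_sided_ideals R"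
      using sub(4) by simp
    have "{u \<in> unit_space G. r \<in> (\<lambda>u \<in> unit_space G. \<rho>\<^sub>1 u <+>\<^bsub>R\<^esub> \<rho>\<^sub>2 u) u}
        = {u \<in> unit_space G. r \<in> \<rho>\<^sub>1 u <+>\<^bsub>R\<^esub> \<rho>\<^sub>2 u}" for r by auto
    then show "openin (gtop G) {u \<in> unit_space G. r \<in> (\<lambda>u \<in> unit_space G. \<rho>\<^sub>1 u <+>\<^bsub>R\<^esub> \<rho>\<^sub>2 u) u}" for r
      using set_add_mem_open[OF \<rho>] by metis
  qed (use invariant_functionsD(2)[OF \<rho>(1)] invariant_functionsD(2)[OF \<rho>(2)] src_in rng_in in simp)
  then show ?thesis
    using sub(1-3) \<rho> invariant_functionsD(1) by (auto simp: least_def Upper_def)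
qed

lemma greatest_F:
  assumes \<rho>: "\<rho>\<^sub>1 \<in> invariant_functions R G" "\<rho>\<^sub>2 \<in> invariant_functions R G"
  shows "greatest F (\<lambda>u \<in> unit_space G. \<rho>\<^sub>1 u \<inter> \<rho>\<^sub>2 u) (Lower F {\<rho>\<^sub>1, \<rho>\<^sub>2})"
proof -
  note I = invariant_functionsD(1)[OF \<rho>(1)] invariant_functionsD(1)[OF \<rho>(2)]
  have "(\<lambda>u \<in> unit_space G. \<rho>\<^sub>1 u \<inter> \<rho>\<^sub>2 u) \<in> invariant_functions R G"
    unfolding invariant_functions_iff
  proof (intro conjI ballI)
    have "\<rho>\<^sub>1 u \<inter> \<rho>\<^sub>2 u \<in> two_sided_ideals R" if "u \<in> unit_space G" for u
      using that by (intro two_sided_ideals_Int I m_closed l_distr r_distr)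
    then show "(\<lambda>u \<in> unit_space G. \<rho>\<^sub>1 u \<inter> \<rho>\<^sub>2 u) \<in> unit_space G \<rightarrow>\<^sub>E two_sided_ideals R" by simp
    fix r assume r: "r \<in> carrier R"
    have eq: "{u \<in> unit_space G. r \<in> (\<lambda>u \<in> unit_space G. \<rho>\<^sub>1 u \<inter> \<rho>\<^sub>2 u) u}
        = {u \<in> unit_space G. r \<in> \<rho>\<^sub>1 u} \<inter> {u \<in> unit_space G. r \<in> \<rho>\<^sub>2 u}" by auto
    show "openin (gtop G) {u \<in> unit_space G. r \<in> (\<lambda>u \<in> unit_space G. \<rho>\<^sub>1 u \<inter> \<rho>\<^sub>2 u) u}"
      unfolding eq by (intro openin_Int invariant_functionsD(3) \<rho> r)
  qed (use invariant_functionsD(2)[OF \<rho>(1)] invariant_functionsD(2)[OF \<rho>(2)] src_in rng_in in simp)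
  then show ?thesis
    using \<rho> by (auto simp: greatest_def Lower_def)
qed

lemma lattice_F: "Lattice.lattice F"
proof -
  \<comment> \<open>The order compares values at units only; elsewhere both functions are
    \<open>undefined\<close>.\<close>
  have antisym: "\<rho>\<^sub>1 = \<rho>\<^sub>2" if "\<rho>\<^sub>1 \<in> invariant_functions R G" "\<rho>\<^sub>2 \<in> invariant_functions R G"
    "\<forall>u \<in> unit_space G. \<rho>\<^sub>1 u \<subseteq> \<rho>\<^sub>2 u" "\<forall>u \<in> unit_space G. \<rho>\<^sub>2 u \<subseteq> \<rho>\<^sub>1 u" for \<rho>\<^sub>1 \<rho>\<^sub>2
  proof (rule PiE_ext)
    show "\<rho>\<^sub>1 \<in> unit_space G \<rightarrow>\<^sub>E two_sided_ideals R" "\<rho>\<^sub>2 \<in> unit_space G \<rightarrow>\<^sub>E two_sided_ideals R"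
      using that(1,2) by (simp_all add: invariant_functions_def)
    show "\<rho>\<^sub>1 u = \<rho>\<^sub>2 u" if "u \<in> unit_space G" for u
      using that \<open>\<forall>u \<in> unit_space G. \<rho>\<^sub>1 u \<subseteq> \<rho>\<^sub>2 u\<close> \<open>\<forall>u \<in> unit_space G. \<rho>\<^sub>2 u \<subseteq> \<rho>\<^sub>1 u\<close>
      by blast
  qed
  have "partial_order F"
    by unfold_locales
      (unfold F_simps, simp_all only: refl simp_thms, blast, rule antisym, assumption+, blast)
  then show ?thesis
    using least_F greatest_F unfolding F_simps(1)[symmetric]
    by (intro Lattice.lattice.intro upper_semilattice.intro lower_semilattice.intro
        upper_semilattice_axioms.intro lower_semilattice_axioms.intro) blast+
qed

text \<open>\<open>join\<close> is defined by choosing some least upper bound, so uniqueness of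
  least elements is what identifies it with the pointwise sum.\<close>

lemma join_F:
  assumes "\<rho>\<^sub>1 \<in> invariant_functions R G" "\<rho>\<^sub>2 \<in> invariant_functions R G"
  shows "\<rho>\<^sub>1 \<squnion>\<^bsub>F\<^esub> \<rho>\<^sub>2 = (\<lambda>u \<in> unit_space G. \<rho>\<^sub>1 u <+>\<^bsub>R\<^esub> \<rho>\<^sub>2 u)"
proof -
  interpret F: Lattice.lattice F by (rule lattice_F)
  show ?thesis
    using F.sup_of_two_least[of \<rho>\<^sub>1 \<rho>\<^sub>2] least_F[OF assms] assms F.least_unique
    unfolding join_def by fastforce
qed

lemma meet_F:
  assumes "\<rho>\<^sub>1 \<in> invariant_functions R G" "\<rho>\<^sub>2 \<in> invariant_functions R G"
  shows "\<rho>\<^sub>1 \<sqinter>\<^bsub>F\<^esub> \<rho>\<^sub>2 = (\<lambda>u \<in> unit_space G. \<rho>\<^sub>1 u \<inter> \<rho>\<^sub>2 u)"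
proof -
  interpret F: Lattice.lattice F by (rule lattice_F)
  show ?thesis
    using F.inf_of_two_greatest[of \<rho>\<^sub>1 \<rho>\<^sub>2] greatest_F[OF assms] assms F.greatest_unique
    unfolding meet_def by fastforce
qed

end

text \<open>\<open>M\<close> enters as a partial order only: every element of \<open>M\<close> is an
  \<open>h x\<close>, and since \<open>h\<close> preserves and reflects the order, bounds in
  \<open>L\<close> are sent to bounds in \<open>M\<close>. The ideals of the Steinberg algebra thus
  inherit their lattice structure from the invariant functions.\<close>

lemma order_isomorphism_lattice_isomorphism:
  fixes L (structure)
  assumes L: "Lattice.lattice L" and M: "partial_order M"
    and h: "bij_betw h (carrier L) (carrier M)"
    and le: "\<And>x y. \<lbrakk>x \<in> carrier L; y \<in> carrier L\<rbrakk> \<Longrightarrow> x \<sqsubseteq> y \<longleftrightarrow> h x \<sqsubseteq>\<^bsub>M\<^esub> h y"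
  shows "lattice_isomorphism L M h"
proof -
  interpret L: Lattice.lattice L by (rule L)
  interpret M: partial_order M by (rule M)
  have im: "h ` carrier L = carrier M" and hM: "\<And>x. x \<in> carrier L \<Longrightarrow> h x \<in> carrier M"
    using h by (auto simp: bij_betw_def)
  have least: "least M (h (x \<squnion> y)) (Upper M {h x, h y})"
    and greatest: "greatest M (h (x \<sqinter> y)) (Lower M {h x, h y})"
    if "x \<in> carrier L" "y \<in> carrier L" for x y
  proof -
    have "h z \<sqsubseteq>\<^bsub>M\<^esub> h w \<longleftrightarrow> z \<sqsubseteq> w" if "z \<in> carrier L" "w \<in> carrier L" for z w
      using le that by simp
    then show "least M (h (x \<squnion> y)) (Upper M {h x, h y})" "greatest M (h (x \<sqinter> y)) (Lower M {h x, h y})"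
      using that hM L.join_left L.join_right L.join_le L.meet_left L.meet_right L.meet_le
      unfolding least_def Upper_def greatest_def Lower_def im[symmetric] by auto
  qed
  have "\<exists>s. least M s (Upper M {x, y})" "\<exists>s. greatest M s (Lower M {x, y})"
    if "x \<in> carrier M" "y \<in> carrier M" for x y
    using that least greatest unfolding im[symmetric] by blast+
  then interpret M: Lattice.lattice M by unfold_locales
  have "h (x \<squnion> y) = h x \<squnion>\<^bsub>M\<^esub> h y" "h (x \<sqinter> y) = h x \<sqinter>\<^bsub>M\<^esub> h y"
    if "x \<in> carrier L" "y \<in> carrier L" for x y
    using that least greatest hM M.least_unique M.greatest_unique
      M.sup_of_two_least M.inf_of_two_greatest
    unfolding join_def[of M] meet_def[of M] by metis+
  then show ?thesis
    unfolding lattice_isomorphism_def using L M.lattice_axioms h by blast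
qed

theorem theorem5p4:
  fixes G :: "'g groupoid_structure" and R :: "'r ring"
  assumes "ample_Hausdorff_groupoid G"
    and "strongly_effective G"
    and "cring R"
  defines "A \<equiv> steinberg_algebra R G"
    and "F \<equiv> invariant_function_lattice R G"
  shows "\<exists>\<Gamma>. bij_betw \<Gamma> (invariant_functions R G) (two_sided_ideals A) \<and>
    (\<forall>\<rho> \<in> invariant_functions R G.
       \<Gamma> \<rho> = module_span R A {c \<odot>\<^bsub>A\<^esub> char_fun R G B | c B.
         compact_open_bisection G B \<and>
         c \<in> carrier R \<inter> (\<Inter>u \<in> invariant_hull G (src G ` B). \<rho> u)}) \<and>
    Lattice.lattice F \<and>
    (\<forall>\<rho>\<^sub>1 \<in> invariant_functions R G. \<forall>\<rho>\<^sub>2 \<in> invariant_functions R G. \<forall>u \<in> unit_space G.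
       (\<rho>\<^sub>1 \<squnion>\<^bsub>F\<^esub> \<rho>\<^sub>2) u = \<rho>\<^sub>1 u <+>\<^bsub>R\<^esub> \<rho>\<^sub>2 u \<and>
       (\<rho>\<^sub>1 \<sqinter>\<^bsub>F\<^esub> \<rho>\<^sub>2) u = \<rho>\<^sub>1 u \<inter> \<rho>\<^sub>2 u) \<and>
    lattice_isomorphism F (ideal_lattice A) \<Gamma>"
proof -
  interpret steinberg G R
    using assms(1,3) by (intro steinberg.intro)
  have po: "partial_order (ideal_lattice (steinberg_algebra R G))"
    by unfold_locales (auto simp: ideal_lattice_def)
  have bij: "bij_betw ideal_of (invariant_functions R G) (two_sided_ideals (steinberg_algebra R G))"
    using ideal_of_bij assms(2) .
  have iso: "lattice_isomorphism (invariant_function_lattice R G)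
      (ideal_lattice (steinberg_algebra R G)) ideal_of"
  proof (rule order_isomorphism_lattice_isomorphism[OF lattice_F po])
    show "bij_betw ideal_of (carrier (invariant_function_lattice R G))
        (carrier (ideal_lattice (steinberg_algebra R G)))"
      using bij by (simp add: ideal_lattice_def)
    show "\<rho>\<^sub>1 \<sqsubseteq>\<^bsub>invariant_function_lattice R G\<^esub> \<rho>\<^sub>2
        \<longleftrightarrow> ideal_of \<rho>\<^sub>1 \<sqsubseteq>\<^bsub>ideal_lattice (steinberg_algebra R G)\<^esub> ideal_of \<rho>\<^sub>2"
      if "\<rho>\<^sub>1 \<in> carrier (invariant_function_lattice R G)"
        "\<rho>\<^sub>2 \<in> carrier (invariant_function_lattice R G)" for \<rho>\<^sub>1 \<rho>\<^sub>2
      using that ideal_of_mono_iff by (simp add: ideal_lattice_def)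
  qed
  show ?thesis
    unfolding A_def F_def
    using bij ideal_of_eq_span lattice_F join_F meet_F iso by (intro exI[of _ ideal_of]) simp
qed

end
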